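(* The following reductions in a tie sequence do not change the knot type (that is, the tie diagrams of the sequence before and after the reduction represent equivalent knots): (0) $L_oR_iC_oT$ reduces to $\emptyset$ (the unknot); (I) $[\dots]L_iR_oL_iC_oT$ reduces to $[\dots]L_iC_ot_1$, and $[\dots]R_iL_oR_iC_oT$ reduces to $[\dots]R_iC_ot_1$; (II) $[\dots]C_iR_oL_iC_oT$ and $[\dots]C_iL_oR_iC_oT$ both reduce to $[\dots]$; (III) $f(L,R)$ reduces to $\emptyset$; (IV) $[\dots]Cf(L,R)$ reduces to $[\dots]C\ast$. Here $[\dots]$ is some list of tie moves, $f(L,R)$ is a (nonempty) sequence of alternating left and right moves (starting in any order), and $\ast$ is the first $L$ or $R$ move of $f(L,R)$. Reductions (III) and (IV) are applied to whole sequences that arise after reduction (II) has been applied to a tie sequence. Where directions are not listed, any choice with alternating directions is allowed.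
   Context: Tie sequences. The tie moves are $L_i,L_o,R_i,R_o,C_i,C_o$; the letter names a region (left, right, center) and the subscript a direction ($i$ = in, $o$ = out). A tie sequence is a finite list of tie moves followed by the symbol $T$ (tuck) such that: it begins with $L_i$ or $L_o$; no two consecutive moves have the same letter; directions alternate between in and out; it ends with $L_oR_iC_oT$ or $R_oL_iC_oT$. There is no bound on the number of moves. Tie diagrams. In the plane, the passive strand starts at a point $b$ at the bottom, runs up the "straight strand" to a point $x$, then up the left side of the "neck loop", clockwise over its top, and down its right side to a point $a$ just to the right of $x$. The active strand starts at $a$; its first move (an $L$ move) carries it leftward across the passive strand at $x$, closing the neck loop (the first crossing, counted as the topmost crossing of the straight strand). $C$ is the region inside the neck loop; $L$ and $R$ are the regions outside it to the left and right of the straight strand (the active strand never passes above the neck loop). Each further move carries the active strand from its current region to the named region, crossing the passive strand exactly once: across the straight strand between $L$ and $R$, across the left side of the neck loop between $L$ and $C$, across the right side between $R$ and $C$. An in-move means the active strand crosses over, an out-move that it crosses under. Successive crossings on the straight strand are placed lower and lower, and successive crossings on each side of the neck loop are placed higher and higher (farther from the first crossing), so that these moves create no self-crossing of the active strand. Tuck: if the sequence ends with $R_oL_iC_oT$, let $\ell$ be the arc of the active strand in region $R$ between the crossings of the final $R_o$ and final $L_i$. After $C_o$ the active strand leaves $C$ passing over the right side of the neck loop, above all earlier crossings there (crossing $t_1$, an $R_i$ move), then crosses $\ell$ over (crossing $t_2$) and then under (crossing $t_3$), where $t_2$ precedes $t_3$ along $\ell$ from $R_o$ to $L_i$, and then runs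 to $b$ with no further crossings. If the sequence ends with $L_oR_iC_oT$, interchange $L$ and $R$ in this description (so $t_1$ is an $L_i$ move). The resulting closed curve with crossing information is the tie diagram of the sequence. A list of moves without $T$ that begins with an $L$ move and ends with an $L$ or $R$ move (the symbol $t_1$ standing for $L_i$ or $R_i$) also has a tie diagram, drawn by the same rules: after the last move the active strand runs to $b$ with no further crossings. $\emptyset$ denotes the crossingless diagram of the unknot. *)

theory Defs
  imports "HOL-Analysis.Analysis"
begin

section \<open>Knots and knot diagrams\<close>

type_synonym point3 = "real \<times> real \<times> real"

text \<open>
  Ambient isotopy: a continuous family of homeomorphisms of three-space that starts at the identity
  and ends at a homeomorphism carrying one knot onto the other.
\<close>

definition equivalent_knots :: "point3 set \<Rightarrow> point3 set \<Rightarrow> bool" where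
  "equivalent_knots K K' \<longleftrightarrow>
     (\<exists>h. homotopic_with_canon (\<lambda>f. \<exists>g. homeomorphism UNIV UNIV f g) UNIV UNIV id h \<and> h ` K = K')"

text \<open>
  A diagram is the cyclic list of the vertices \<open>(x, y, z)\<close> of a closed polygonal curve.
  The plane curve is the projection to \<open>(x, y)\<close>; the coordinate \<open>z\<close> only carries the crossing
  information: where two strands cross in the plane, the one with the larger \<open>z\<close> is the over-strand.
  The closed polygon itself is then a knot with this diagram.
\<close>

type_synonym diagram = "point3 list"

fun polyline :: "point3 list \<Rightarrow> point3 set" where
  "polyline (p # q # ps) = closed_segment p q \<union> polyline (q # ps)"
| "polyline ps = {}"

definition knot_of :: "diagram \<Rightarrow> point3 set" where
  "knot_of D = polyline (D @ [hd D])"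

definition equivalent_diagrams :: "diagram \<Rightarrow> diagram \<Rightarrow> bool" where
  "equivalent_diagrams D D' \<longleftrightarrow> equivalent_knots (knot_of D) (knot_of D')"

text \<open>The crossingless diagram of the unknot, drawn as a triangle.\<close>

definition empty_diagram :: diagram where
  "empty_diagram = [(0, 0, 0), (1, 0, 0), (0, 1, 0)]"


section \<open>Tie sequences\<close>

datatype region = Left | Right | Center
datatype direction = In | Out
datatype move = Move (region_of: region) (direction_of: direction)

abbreviation L\<^sub>i :: move where "L\<^sub>i \<equiv> Move Left In"
abbreviation L\<^sub>o :: move where "L\<^sub>o \<equiv> Move Left Out"
abbreviation R\<^sub>i :: move where "R\<^sub>i \<equiv> Move Right In"
abbreviation R\<^sub>o :: move where "R\<^sub>o \<equiv> Move Right Out"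
abbreviation C\<^sub>i :: move where "C\<^sub>i \<equiv> Move Center In"
abbreviation C\<^sub>o :: move where "C\<^sub>o \<equiv> Move Center Out"

text \<open>\<open>Tucked ms\<close> is the list \<open>ms\<close> followed by \<open>T\<close>; \<open>Plain ms\<close> is the list \<open>ms\<close> without \<open>T\<close>.\<close>

datatype tie_word = Plain "move list" | Tucked "move list"

fun tie_sequence :: "tie_word \<Rightarrow> bool" where
  "tie_sequence (Tucked ms) \<longleftrightarrow>
     ms \<noteq> [] \<and> hd ms \<in> {L\<^sub>i, L\<^sub>o} \<and>
     successively (\<lambda>m m'. region_of m \<noteq> region_of m') ms \<and>
     successively (\<lambda>m m'. direction_of m \<noteq> direction_of m') ms \<and>
     ((\<exists>p. ms = p @ [L\<^sub>o, R\<^sub>i, C\<^sub>o]) \<or> (\<exists>p. ms = p @ [R\<^sub>o, L\<^sub>i, C\<^sub>o]))"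
| "tie_sequence (Plain ms) \<longleftrightarrow> False"


section \<open>Tie diagrams\<close>

text \<open>
  The passive strand lies in the plane \<open>z = 0\<close>, with the straight strand on the line \<open>x = 0\<close>, and the
  sides of the neck loop on the lines \<open>x = -1\<close> (left) and \<open>x = 1\<close> (right). It starts at
  \<open>b = (0, -m)\<close>, where \<open>m\<close> is the number of crossings on it; the straight strand ends at \<open>(0, 0)\<close>,
  the place of the first crossing, and the neck loop ends at \<open>a = (1, 0)\<close>. The vertices are listed along the passive strand from \<open>b\<close>; the next vertex, \<open>a\<close>, is the
  first one of the active strand.
\<close>

definition passive_strand :: "nat \<Rightarrow> point3 list" where
  "passive_strand m =
     [(0, - real m, 0), (0, 0, 0), (-1, 1, 0), (-1, real m + 1, 0), (1, real m + 1, 0)]"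

text \<open>
  Place in the plane where the active strand crosses the passive strand when it passes between the
  regions \<open>r\<close> and \<open>r'\<close> after \<open>k\<close> earlier crossings: on the straight strand at height \<open>-k\<close>, on a
  side of the neck loop at height \<open>k + 1\<close>.
\<close>

definition crossing :: "region \<Rightarrow> region \<Rightarrow> nat \<Rightarrow> real \<times> real" where
  "crossing r r' k =
     (if {r, r'} = {Left, Center} then (-1, real k + 1)
      else if {r, r'} = {Right, Center} then (1, real k + 1)
      else (0, - real k))"

text \<open>
  The arc of the active strand that runs in region \<open>r\<close> after \<open>k\<close> crossings goes horizontally from its
  first crossing to the vertical line \<open>x = column r k\<close>, along this line, and horizontally to its
  second crossing. In the regions \<open>Left\<close> and \<open>Right\<close> later arcs enclose the earlier ones, and in
  \<open>Center\<close> they lie above the earlier ones. The arc with \<open>r = Right\<close> and \<open>k = 0\<close> starts at \<open>a\<close>.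
\<close>

fun column :: "region \<Rightarrow> nat \<Rightarrow> real" where
  "column Left k = - (real k + 1)"
| "column Right k = real k + 1"
| "column Center k = 0"

fun level :: "direction \<Rightarrow> real" where
  "level In = 1"
| "level Out = -1"

text \<open>The active strand along the moves \<open>ms\<close>, when it is in region \<open>r\<close> after \<open>k\<close> crossings.\<close>

fun active_strand :: "nat \<Rightarrow> region \<Rightarrow> move list \<Rightarrow> point3 list" where
  "active_strand k r [] = []"
| "active_strand k r (Move r' d # ms) =
     (let (x, y) = crossing r r' k in
      [(column r k, y, 0), (x, y, level d), (column r' (k + 1), y, 0)]
        @ active_strand (k + 1) r' ms)"

text \<open>
  The tuck of a sequence with \<open>n\<close> moves before \<open>T\<close>, the last three of them being
  \<open>R\<^sub>o L\<^sub>i C\<^sub>o\<close> (then \<open>r = Right\<close>) or \<open>L\<^sub>o R\<^sub>i C\<^sub>o\<close> (then \<open>r = Left\<close>). The arc \<open>\<ell>\<close> follows \<open>n - 2\<close> crossings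
  and ends at the crossing \<open>(0, -(n - 2))\<close>. Its vertical part is on the line \<open>x = s * (n - 1)\<close> and
  covers at least the heights from \<open>-(n - 3)\<close> down to \<open>-(n - 2)\<close>. The active strand, arriving
  from \<open>t\<^sub>1\<close> on the line \<open>x = s * (n + 2)\<close>, crosses this part twice: over at height \<open>-(n - 3) - 1/3\<close>
  (\<open>t\<^sub>2\<close>) and back under at height \<open>-(n - 3) - 2/3\<close> (\<open>t\<^sub>3\<close>).
\<close>

definition tuck_hook :: "region \<Rightarrow> nat \<Rightarrow> point3 list" where
  "tuck_hook r n =
     (let s = (if r = Left then -1 else 1);
          y2 = - (real n - 3) - 1/3;
          y3 = - (real n - 3) - 2/3
      in [(s * (real n + 2), y2, 0), (s * (real n - 1), y2, 1), (s * (real n - 3/2), y2, 0),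
          (s * (real n - 3/2), y3, 0), (s * (real n - 1), y3, -1), (s * (real n + 2), y3, 0)])"

text \<open>
  After the last crossing the active strand runs to \<open>b\<close>, around the corner below its last arc.
  Besides the crossings of its \<open>n\<close> moves, a sequence with \<open>T\<close> has the crossing \<open>t\<^sub>1\<close> on the passive
  strand, which is drawn as one more in-move to the region of \<open>\<ell>\<close>.
\<close>

fun tie_diagram :: "tie_word \<Rightarrow> diagram" where
  "tie_diagram (Plain ms) =
     (let n = length ms in
      passive_strand n @ active_strand 0 Right ms
        @ [(column (region_of (last ms)) n, - real n, 0)])"
| "tie_diagram (Tucked ms) =
     (let n = length ms; r = region_of (ms ! (n - 3)) in
      passive_strand (n + 1) @ active_strand 0 Right (ms @ [Move r In])
        @ tuck_hook r n @ [(column r (n + 1), - real (n + 1), 0)])"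


section \<open>Lists occurring in the reductions\<close>

text \<open>The lists \<open>[\<dots>]\<close> left over when \<open>[\<dots>] C\<^sub>i R\<^sub>o L\<^sub>i C\<^sub>o T\<close> or \<open>[\<dots>] C\<^sub>i L\<^sub>o R\<^sub>i C\<^sub>o T\<close> is reduced to \<open>[\<dots>]\<close>.\<close>

definition remainder_of_tie_sequence :: "move list \<Rightarrow> bool" where
  "remainder_of_tie_sequence ms \<longleftrightarrow>
     tie_sequence (Tucked (ms @ [C\<^sub>i, R\<^sub>o, L\<^sub>i, C\<^sub>o])) \<or>
     tie_sequence (Tucked (ms @ [C\<^sub>i, L\<^sub>o, R\<^sub>i, C\<^sub>o]))"

definition alternating_left_right :: "move list \<Rightarrow> bool" where
  "alternating_left_right f \<longleftrightarrow>
     f \<noteq> [] \<and> region_of ` set f \<subseteq> {Left, Right} \<and>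
     successively (\<lambda>m m'. region_of m \<noteq> region_of m') f"

end

theory Submission
  imports Defs
begin

text \<open>
  Everything is derived from one elementary isotopy: if a triangle meets the rest of a polygonal knot only in
  two of its vertices, the side joining them can be pushed across the triangle onto the other two sides.
  From this it follows that an arc which passes below everything else (and has a simple projection) may be
  replaced by any other such arc with the same endpoints, since both can be pulled down and straightened in a
  plane below the knot; by reflection the same holds for arcs that pass above everything else.

  Each reduction is a short sequence of such replacements. For the tuck, the end of the active strand between
  \<open>t\<^sub>3\<close> and the last crossing of the straight strand is an under-arc; shortening it frees the arc \<open>\<ell>\<close>, which
  together with its continuation through \<open>C\<^sub>o\<close> is again an under-arc, and afterwards the end of the active
  strand is an over-arc. A final crossing on the straight strand is a kink. The crossings made before are
  enclosed in a box which the replaced arcs avoid, so only finitely many explicit edges have to be compared.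
\<close>

section \<open>Equivalence of knots\<close>

text \<open>An isotopy is constructed only once, for the triangle. A push of constant width would
  move the strands attached at the two vertices, so its width has to shrink to zero there; because
  the rest of the knot is a finite union of segments, some rate of shrinking is slow enough to cover
  the side and fast enough to miss the rest. Whole arcs are replaced, instead of chaining
  Reidemeister moves, because the old and the new arc then need no relation to each other: only the
  position of each against the rest of the knot is checked. The box works because tie diagrams are
  drawn in layers. After N moves the prefix lies in |x| <= N + 1, its crossings have integer heights
  from 1 - N to N, and later moves are drawn further out. Outside the box all coordinates are affine
  in N, except for the height v of the last crossing of the prefix, so every comparison of edges is
  a linear inequality valid for all N >= 1. Each reduction is computed for one choice of sides and
  directions; reflections in x and z supply the others.\<close>

definition selfhomeo :: "(point3 \<Rightarrow> point3) \<Rightarrow> bool" where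
  "selfhomeo f \<longleftrightarrow> (\<exists>g. homeomorphism UNIV UNIV f g)"

lemma equivalent_knots_alt:
  "equivalent_knots K K' \<longleftrightarrow> (\<exists>h. homotopic_with_canon selfhomeo UNIV UNIV id h \<and> h ` K = K')"
  unfolding equivalent_knots_def selfhomeo_def[abs_def] ..

lemma selfhomeo_comp: "selfhomeo f \<Longrightarrow> selfhomeo g \<Longrightarrow> selfhomeo (g \<circ> f)"
  unfolding selfhomeo_def by (meson homeomorphism_compose)

lemma equivalent_knots_refl: "equivalent_knots K K"
proof -
  have "selfhomeo id"
    unfolding selfhomeo_def id_def by (rule exI) (rule homeomorphism_ident)
  then have "homotopic_with_canon selfhomeo UNIV UNIV id id"
    by (subst homotopic_with_refl) auto
  then show ?thesis
    unfolding equivalent_knots_alt by (intro exI[of _ id]) simp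
qed

lemma equivalent_knots_trans [trans]:
  assumes "equivalent_knots K L" "equivalent_knots L M"
  shows "equivalent_knots K M"
proof -
  obtain f where f: "homotopic_with_canon selfhomeo UNIV UNIV id f" "f ` K = L"
    using assms(1) unfolding equivalent_knots_alt by blast
  obtain g where g: "homotopic_with_canon selfhomeo UNIV UNIV id g" "g ` L = M"
    using assms(2) unfolding equivalent_knots_alt by blast
  have sf: "selfhomeo f" and cf: "continuous_on UNIV f"
    using homotopic_with_imp_property[OF f(1)] homotopic_with_imp_continuous[OF f(1)] by simp_all
  have "homotopic_with_canon selfhomeo UNIV UNIV (id \<circ> f) (g \<circ> f)"
    using g(1)
    by (rule homotopic_with_compose_continuous_map_right[where p=selfhomeo])
      (simp_all add: cf sf selfhomeo_comp)
  then have "homotopic_with_canon selfhomeo UNIV UNIV id (g \<circ> f)"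
    using homotopic_with_trans[OF f(1)] by simp
  then show ?thesis
    unfolding equivalent_knots_alt using f(2) g(2) by (auto simp: image_comp[symmetric])
qed

text \<open>The isotopy is conjugated by \<open>\<phi>\<close>. Since \<open>\<phi>\<close> itself
  need not be isotopic to the identity, reflections are allowed.\<close>

lemma equivalent_knots_image:
  assumes "equivalent_knots K L" "homeomorphism UNIV UNIV \<phi> \<psi>"
  shows "equivalent_knots (\<phi> ` K) (\<phi> ` L)"
proof -
  obtain f where f: "homotopic_with_canon selfhomeo UNIV UNIV id f" "f ` K = L"
    using assms(1) unfolding equivalent_knots_alt by blast
  have c: "continuous_on UNIV \<phi>" "continuous_on UNIV \<psi>" "selfhomeo \<phi>" "selfhomeo \<psi>"
    and inv: "\<psi> \<circ> \<phi> = id" "\<phi> \<circ> \<psi> = id"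
    using assms(2) homeomorphism_symD[OF assms(2)] by (auto simp: selfhomeo_def) (simp_all add: homeomorphism_def fun_eq_iff)
  have "homotopic_with_canon selfhomeo UNIV UNIV (\<phi> \<circ> id) (\<phi> \<circ> f)"
    using f(1)
    by (rule homotopic_with_compose_continuous_map_left[where p=selfhomeo])
      (simp_all add: c selfhomeo_comp)
  then have "homotopic_with_canon selfhomeo UNIV UNIV (\<phi> \<circ> id \<circ> \<psi>) (\<phi> \<circ> f \<circ> \<psi>)"
    by (rule homotopic_with_compose_continuous_map_right[where p=selfhomeo])
      (simp_all add: c selfhomeo_comp)
  then have "homotopic_with_canon selfhomeo UNIV UNIV id (\<phi> \<circ> f \<circ> \<psi>)"
    using inv by simp
  moreover have "(\<phi> \<circ> f \<circ> \<psi>) ` \<phi> ` K = \<phi> ` L"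
    using fun_cong[OF inv(1)] f(2)[symmetric] by (simp add: image_image)
  ultimately show ?thesis
    unfolding equivalent_knots_alt by (intro exI conjI)
qed

text \<open>Inverting each map of the family would require joint continuity of the inverses.
  Composing the whole isotopy with the fixed inverse \<open>g\<close> of its end map gives an
  isotopy from \<open>g\<close> to the identity instead, which is then reversed.\<close>

lemma equivalent_knots_sym:
  assumes "equivalent_knots K L"
  shows "equivalent_knots L K"
proof -
  obtain f where f: "homotopic_with_canon selfhomeo UNIV UNIV id f" "f ` K = L"
    using assms(1) unfolding equivalent_knots_alt by blast
  have "selfhomeo f"
    using homotopic_with_imp_property[OF f(1)] by simp
  then obtain g where g: "homeomorphism UNIV UNIV f g" unfolding selfhomeo_def by blast
  have c: "continuous_on UNIV g" "selfhomeo g" and inv: "g \<circ> f = id"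
    using g homeomorphism_symD[OF g] by (auto simp: selfhomeo_def) (simp_all add: homeomorphism_def fun_eq_iff)
  have "homotopic_with_canon selfhomeo UNIV UNIV (g \<circ> id) (g \<circ> f)"
    using f(1)
    by (rule homotopic_with_compose_continuous_map_left[where p=selfhomeo])
      (simp_all add: c selfhomeo_comp)
  then have "homotopic_with_canon selfhomeo UNIV UNIV id g"
    using inv by (simp add: homotopic_with_sym)
  moreover have "g ` L = K"
    using fun_cong[OF inv] f(2)[symmetric] by (simp add: image_image)
  ultimately show ?thesis
    unfolding equivalent_knots_alt by (intro exI conjI)
qed

lemma equivalent_knots_image_iff:
  assumes "homeomorphism UNIV UNIV \<phi> \<psi>"
  shows "equivalent_knots (\<phi> ` K) (\<phi> ` L) \<longleftrightarrow> equivalent_knots K L"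
proof
  assume "equivalent_knots (\<phi> ` K) (\<phi> ` L)"
  then have "equivalent_knots (\<psi> ` \<phi> ` K) (\<psi> ` \<phi> ` L)"
    by (rule equivalent_knots_image) (rule homeomorphism_symD[OF assms])
  moreover have "\<psi> ` \<phi> ` X = X" for X
    by (simp add: image_image homeomorphism_apply1[OF assms])
  ultimately show "equivalent_knots K L" by simp
qed (rule equivalent_knots_image[OF _ assms])

section \<open>Moving a segment across a triangle\<close>

text \<open>
  In standard position the triangle has the vertices \<open>(-1, 0, 0)\<close>, \<open>(1, 0, 0)\<close>, \<open>(0, 1, 0)\<close>; it is the zero
  set of \<open>hat_dist\<close>. The map \<open>push e 1\<close> moves points parallel to the second axis; it lifts the side on the
  first axis to the other two sides and fixes every \<open>w\<close> with \<open>e * (1 - \<bar>fst w\<bar>) \<le> hat_dist w\<close>.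
\<close>

fun hat_dist :: "point3 \<Rightarrow> real" where
  "hat_dist (x, y, z) = max \<bar>z\<bar> (max (- y) (y - (1 - \<bar>x\<bar>)))"

text \<open>For \<open>z = 0\<close> and t = 1 - |x| >= 0 this is a tent in y: it rises with slope
  1/e from 0 at y = - e t to t at y = 0, and falls with slope - 1/(1 + e) to 0 at y = (1 + e) t. The
  fall is slower than 1, so adding \<open>s * bump\<close> to y with s <= 1 keeps it strictly
  increasing. The margin around the triangle is proportional to t and closes at both ends of the
  base.\<close>

fun bump :: "real \<Rightarrow> point3 \<Rightarrow> real" where
  "bump e (x, y, z) =
     max 0 (min (y / e + (1 - \<bar>x\<bar>)) ((1 - \<bar>x\<bar>) - y / (1 + e)) - \<bar>z\<bar> / e)"

fun push :: "real \<Rightarrow> real \<Rightarrow> point3 \<Rightarrow> point3" where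
  "push e s (x, y, z) = (x, y + s * bump e (x, y, z), z)"

lemma min_le_hat:
  fixes e y t :: real
  assumes "e > 0"
  shows "min (y / e + t) (t - y / (1 + e)) \<le> t"
proof (cases "y \<ge> 0")
  case True
  then have "y / (1 + e) \<ge> 0" using assms by simp
  then show ?thesis by linarith
next
  case False
  then have "y / e \<le> 0" using assms by (simp add: divide_nonpos_pos)
  then show ?thesis by linarith
qed

lemma bump_eq_0:
  assumes "e > 0" "e * (1 - \<bar>fst w\<bar>) \<le> hat_dist w"
  shows "bump e w = 0"
proof -
  obtain x y z where w: "w = (x, y, z)" by (cases w)
  define t where "t = 1 - \<bar>x\<bar>"
  consider "e * t \<le> \<bar>z\<bar>" | "e * t \<le> - y" | "e * t \<le> y - t"
    using assms(2) unfolding w t_def by (simp add: le_max_iff_disj) blast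
  then have "min (y / e + t) (t - y / (1 + e)) - \<bar>z\<bar> / e \<le> 0"
  proof cases
    case 1
    then have "t \<le> \<bar>z\<bar> / e" using assms(1) by (simp add: field_simps)
    then show ?thesis using min_le_hat[OF assms(1), of y t] by linarith
  next
    case 2
    then have "y / e + t \<le> 0" using assms(1) by (simp add: field_simps)
    moreover have "\<bar>z\<bar> / e \<ge> 0" using assms(1) by simp
    ultimately show ?thesis by linarith
  next
    case 3
    then have "t - y / (1 + e) \<le> 0" using assms(1) by (simp add: field_simps)
    moreover have "\<bar>z\<bar> / e \<ge> 0" using assms(1) by simp
    ultimately show ?thesis by linarith
  qed
  then show ?thesis unfolding w t_def by simp
qed

lemma bump_bounds:
  assumes "e > 0"
  shows "0 \<le> bump e w" "bump e w \<le> 1"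
proof -
  obtain x y z where w: "w = (x, y, z)" by (cases w)
  have "\<bar>z\<bar> / e \<ge> 0" using assms(1) by simp
  then show "bump e w \<le> 1"
    using min_le_hat[OF assms(1), of y "1 - \<bar>x\<bar>"] unfolding w by auto
qed (cases w; simp)

lemma bump_mono:
  assumes "e > 0" "y < y'"
  shows "bump e (x, y, z) < bump e (x, y', z) + (y' - y)"
proof -
  have "y / e < y' / e" using assms by (simp add: divide_strict_right_mono)
  moreover have "(y' - y) / (1 + e) < y' - y"
    using assms by (simp add: field_simps)
  then have "y' / (1 + e) - y / (1 + e) < y' - y"
    by (simp add: diff_divide_distrib)
  ultimately show ?thesis using assms(2) by simp linarith
qed

lemma push_inj:
  assumes "e > 0" "0 \<le> s" "s \<le> 1"
  shows "inj (push e s)"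
proof -
  have *: "y + s * bump e (x, y, z) < y' + s * bump e (x, y', z)" if "y < y'" for x y y' z
  proof (cases "s = 0")
    case False
    have "s * bump e (x, y, z) < s * (bump e (x, y', z) + (y' - y))"
      using bump_mono[OF assms(1) that] False assms(2) by simp
    moreover have "s * (y' - y) \<le> 1 * (y' - y)"
      using assms that by (intro mult_right_mono) auto
    ultimately show ?thesis by (simp add: algebra_simps)
  qed (use that in simp)
  show ?thesis
  proof (rule injI)
    fix v w assume eq: "push e s v = push e s w"
    obtain x y z where v: "v = (x, y, z)" by (cases v)
    obtain x' y' z' where w: "w = (x', y', z')" by (cases w)
    show "v = w"
      using eq *[of y y' x z] *[of y' y x z] unfolding v w
      by (cases y y' rule: linorder_cases) (auto simp del: bump.simps)
  qed
qed

lemma continuous_bump [continuous_intros]: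
  assumes "e > 0" "continuous_on S f"
  shows "continuous_on S (\<lambda>w. bump e (f w))"
proof -
  have "bump e = (\<lambda>w. max 0 (min (fst (snd w) / e + (1 - \<bar>fst w\<bar>))
       ((1 - \<bar>fst w\<bar>) - fst (snd w) / (1 + e)) - \<bar>snd (snd w)\<bar> / e))"
    by (auto simp: fun_eq_iff)
  then show ?thesis
    using assms by (auto intro!: continuous_intros)
qed

lemma push_eq: "push e s w = (fst w, fst (snd w) + s * bump e w, snd (snd w))"
  by (cases w) (auto simp del: bump.simps)

lemma push_surj:
  assumes "e > 0" "0 \<le> s" "s \<le> 1"
  shows "surj (push e s)"
proof -
  have "\<exists>w'. push e s w' = w" for w
  proof -
    obtain x y z where w: "w = (x, y, z)" by (cases w)
    define h where "h u = u + s * bump e (x, u, z)" for u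
    have "continuous_on {y - 1 .. y} h"
      unfolding h_def by (intro continuous_intros assms)
    moreover have "h (y - 1) \<le> y"
      using bump_bounds[OF assms(1), of "(x, y - 1, z)"] mult_le_one[of s "bump e (x, y - 1, z)"] assms
      unfolding h_def by (simp del: bump.simps)
    moreover have "y \<le> h y"
      using bump_bounds[OF assms(1), of "(x, y, z)"] assms unfolding h_def by (simp del: bump.simps)
    ultimately obtain u where "h u = y"
      using IVT'[of h "y - 1" y y] by auto
    then show ?thesis unfolding w h_def by (intro exI[of _ "(x, u, z)"]) (simp del: bump.simps)
  qed
  then show ?thesis by (metis surjI)
qed

text \<open>Invariance of domain provides the continuous inverse, so none has to be written
  down.\<close>

lemma selfhomeo_bij:
  assumes "continuous_on UNIV f" "inj f" "surj f"
  shows "selfhomeo f"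
  unfolding selfhomeo_def
  using invariance_of_domain_homeomorphism[of UNIV f] assms by (metis order_refl open_UNIV)

lemma push_isotopy:
  assumes "e > 0"
  shows "equivalent_knots K (push e 1 ` K)"
proof -
  have cont: "continuous_on UNIV (\<lambda>w. push e (fst w) (snd w))"
    unfolding push_eq by (intro continuous_intros assms)
  have "homotopic_with_canon selfhomeo UNIV UNIV (push e 0) (push e 1)"
    unfolding homotopic_with_def
  proof (intro exI conjI ballI)
    show "continuous_map (prod_topology (top_of_set {0..1}) (top_of_set UNIV)) (top_of_set UNIV)
       (\<lambda>w. push e (fst w) (snd w))"
      unfolding prod_topology_subtopology_eu
      using continuous_on_subset[OF cont, of "{0..1} \<times> UNIV"] by simp
    fix s :: real assume s: "s \<in> {0..1}"
    have "continuous_on UNIV (push e s)"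
      unfolding push_eq[abs_def] by (intro continuous_intros assms)
    then show "selfhomeo (\<lambda>w. push e (fst (s, w)) (snd (s, w)))"
      using s push_inj[OF assms, of s] push_surj[OF assms, of s] by (auto intro: selfhomeo_bij)
  qed auto
  moreover have "push e 0 = id" by (auto simp: fun_eq_iff)
  ultimately show ?thesis unfolding equivalent_knots_alt by auto
qed

section \<open>Sets that are fixed by a sufficiently narrow push\<close>

text \<open>The form in which the rest of a knot is handled once an arc is cut out. Finiteness
  yields one width for all segments, and straightness controls the approach to a vertex of the
  triangle.\<close>

definition segment_union :: "point3 set \<Rightarrow> bool" where
  "segment_union R \<longleftrightarrow> (\<exists>S. finite S \<and> R = (\<Union>(a, b)\<in>S. closed_segment a b))"

lemma segment_union_empty [simp]: "segment_union {}"
  unfolding segment_union_def by (intro exI[of _ "{}"]) auto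

lemma segment_union_segment [simp]: "segment_union (closed_segment a b)"
  unfolding segment_union_def by (intro exI[of _ "{(a, b)}"]) auto

lemma segment_union_Un [simp]:
  assumes "segment_union R" "segment_union R'"
  shows "segment_union (R \<union> R')"
proof -
  obtain S S' where "finite S" "R = (\<Union>(a, b)\<in>S. closed_segment a b)"
     "finite S'" "R' = (\<Union>(a, b)\<in>S'. closed_segment a b)"
    using assms unfolding segment_union_def by blast
  then show ?thesis
    unfolding segment_union_def by (intro exI[of _ "S \<union> S'"]) auto
qed

lemma segment_union_polyline [simp]: "segment_union (polyline ps)"
  by (induction ps rule: polyline.induct) auto

lemma segment_union_image:
  assumes "segment_union R" "\<And>a b. f ` closed_segment a b = closed_segment (f a) (f b)"
  shows "segment_union (f ` R)"
proof -
  obtain S where S: "finite S" "R = (\<Union>(a, b)\<in>S. closed_segment a b)"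
    using assms unfolding segment_union_def by blast
  have "f ` R = (\<Union>(a, b)\<in>map_prod f f ` S. closed_segment a b)"
    unfolding S(2) by (auto simp: image_UN assms(2) split_beta)
  then show ?thesis
    unfolding segment_union_def using S(1) by blast
qed

lemma hat_dist_nonneg: "hat_dist w \<ge> 0"
  by (cases w) auto

lemma continuous_hat_dist: "continuous_on S hat_dist"
proof -
  have eq: "hat_dist = (\<lambda>w. max \<bar>snd (snd w)\<bar> (max (- fst (snd w)) (fst (snd w) - (1 - \<bar>fst w\<bar>))))"
    by (auto simp: fun_eq_iff)
  show ?thesis unfolding eq by (intro continuous_intros)
qed

text \<open>By \<open>bump_eq_0\<close> such an \<open>e\<close> makes the push fix S pointwise.
  Meeting the triangle only in base vertices is not by itself a bound: there both sides of the
  inequality vanish, and one \<open>e\<close> has to serve the whole set.\<close>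

definition avoidable :: "point3 set \<Rightarrow> bool" where
  "avoidable S \<longleftrightarrow> (\<exists>e>0. \<forall>w\<in>S. e * (1 - \<bar>fst w\<bar>) \<le> hat_dist w)"

lemma avoidable_mono_eps:
  assumes "e * (1 - \<bar>fst w\<bar>) \<le> hat_dist w" "0 < e'" "e' \<le> e"
  shows "e' * (1 - \<bar>fst w\<bar>) \<le> hat_dist w"
proof (cases "1 - \<bar>fst w\<bar> \<ge> 0")
  case True
  then show ?thesis using assms mult_right_mono[of e' e "1 - \<bar>fst w\<bar>"] by linarith
next
  case False
  then have "e' * (1 - \<bar>fst w\<bar>) \<le> 0" using assms by (simp add: mult_nonneg_nonpos)
  then show ?thesis using hat_dist_nonneg[of w] by linarith
qed

lemma avoidable_Un:
  assumes "avoidable S" "avoidable T"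
  shows "avoidable (S \<union> T)"
proof -
  obtain d e where "d > 0" "\<forall>w\<in>S. d * (1 - \<bar>fst w\<bar>) \<le> hat_dist w"
      "e > 0" "\<forall>w\<in>T. e * (1 - \<bar>fst w\<bar>) \<le> hat_dist w"
    using assms unfolding avoidable_def by blast
  then show ?thesis
    unfolding avoidable_def by (intro exI[of _ "min d e"]) (auto intro: avoidable_mono_eps)
qed

lemma avoidable_UN: "finite I \<Longrightarrow> (\<And>i. i \<in> I \<Longrightarrow> avoidable (S i)) \<Longrightarrow> avoidable (\<Union>i\<in>I. S i)"
proof (induction rule: finite_induct)
  case empty
  then show ?case unfolding avoidable_def by (intro exI[of _ 1]) auto
qed (auto intro: avoidable_Un)

lemma avoidable_disjoint:
  assumes "compact S" "\<And>w. w \<in> S \<Longrightarrow> hat_dist w \<noteq> 0"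
  shows "avoidable S"
proof (cases "S = {}")
  case False
  then obtain v where v: "v \<in> S" "\<And>w. w \<in> S \<Longrightarrow> hat_dist v \<le> hat_dist w"
    using continuous_attains_inf[OF assms(1) _ continuous_hat_dist] by blast
  have pos: "hat_dist v > 0"
    using assms(2)[OF v(1)] hat_dist_nonneg[of v] by linarith
  have "hat_dist v * (1 - \<bar>fst w\<bar>) \<le> hat_dist w" if "w \<in> S" for w
    using mult_left_mono[of "1 - \<bar>fst w\<bar>" 1 "hat_dist v"] v(2)[OF that] pos by linarith
  with pos show ?thesis unfolding avoidable_def by blast
qed (auto simp: avoidable_def intro: exI[of _ 1])

text \<open>Near a vertex of the base, \<^const>\<open>hat_dist\<close> and the width of the push are both
  homogeneous, so one point of the segment decides.\<close>

lemma avoidable_from_corner: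
  assumes \<sigma>: "\<sigma> = 1 \<or> \<sigma> = -1" and a: "a \<noteq> (\<sigma>, 0, 0)"
    and disj: "\<And>w. w \<in> closed_segment (\<sigma>, 0, 0) a \<Longrightarrow> hat_dist w = 0 \<Longrightarrow> w = (1, 0, 0) \<or> w = (-1, 0, 0)"
  shows "avoidable (closed_segment (\<sigma>, 0, 0) a)"
proof -
  define P :: point3 where "P = (\<sigma>, 0, 0)"
  obtain x y z where axyz: "a = (x, y, z)" by (cases a)
  \<comment> \<open>This factor keeps \<open>a'\<close> within horizontal distance 1 of the corner
    P, hence on the same side of x = 0. There |x| is affine, so along the segment from P to
    \<open>a'\<close> both sides of the inequality grow linearly.\<close>
  define \<mu> where "\<mu> = 1 / (1 + \<bar>x - \<sigma>\<bar>)"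
  have \<mu>: "0 < \<mu>" "\<mu> \<le> 1" "\<mu> * \<bar>x - \<sigma>\<bar> \<le> 1" unfolding \<mu>_def by (auto simp: field_simps)
  define a' where "a' = P + \<mu> *\<^sub>R (a - P)"
  have a'_in: "a' \<in> closed_segment P a"
    unfolding a'_def in_segment using \<mu> by (intro exI[of _ \<mu>]) (auto simp: algebra_simps)
  have "a' \<noteq> P" unfolding a'_def using \<mu> a by (auto simp: P_def)
  have a'_xyz: "a' = (\<sigma> + \<mu> * (x - \<sigma>), \<mu> * y, \<mu> * z)"
    unfolding a'_def P_def axyz by simp
  have "\<bar>\<mu> * (x - \<sigma>)\<bar> \<le> 1" using \<mu> by (simp add: abs_mult)
  then have side: "\<sigma> * fst a' \<ge> 0" using \<sigma> unfolding a'_xyz by auto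
  \<comment> \<open>If the opposite base vertex were on the segment, the midpoint (0, 0, 0) of the
    base would be on it too, a zero of \<open>hat_dist\<close> which \<open>disj\<close>
    excludes.\<close>
  have zero_mid: "(1, 0, 0) \<in> closed_segment P a \<Longrightarrow> \<sigma> = 1" "(-1, 0, 0) \<in> closed_segment P a \<Longrightarrow> \<sigma> = -1"
  proof -
    have *: "-P \<notin> closed_segment P a"
    proof
      assume "-P \<in> closed_segment P a"
      then have "closed_segment P (-P) \<subseteq> closed_segment P a"
        by (simp add: closed_segment_subset)
      moreover have "(0, 0, 0) \<in> closed_segment P (-P)"
        unfolding in_segment P_def by (intro exI[of _ "1/2"]) auto
      ultimately show False using disj[of "(0, 0, 0)"] \<sigma> unfolding P_def by auto
    qed
    show "(1, 0, 0) \<in> closed_segment P a \<Longrightarrow> \<sigma> = 1" using * \<sigma> unfolding P_def by auto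
    show "(-1, 0, 0) \<in> closed_segment P a \<Longrightarrow> \<sigma> = -1" using * \<sigma> unfolding P_def by auto
  qed
  then have zero_P: "w = P" if "w \<in> closed_segment P a" "hat_dist w = 0" for w
    using disj[of w] that unfolding P_def by auto
  have pos: "hat_dist a' > 0"
    using zero_P[OF a'_in] \<open>a' \<noteq> P\<close> hat_dist_nonneg[of a'] by force
  have split: "closed_segment P a = closed_segment P a' \<union> closed_segment a' a"
    using Un_closed_segment[OF a'_in] by simp
  have "avoidable (closed_segment P a')"
    unfolding avoidable_def
  proof (intro exI[of _ "hat_dist a'"] conjI ballI pos)
    fix w assume "w \<in> closed_segment P a'"
    then obtain u where u: "0 \<le> u" "u \<le> 1" "w = (1 - u) *\<^sub>R P + u *\<^sub>R a'"
      unfolding in_segment by blast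
    obtain x' y' z' where a'3: "a' = (x', y', z')" by (cases a')
    have w3: "w = (\<sigma> + u * (x' - \<sigma>), u * y', u * z')"
      unfolding u(3) P_def a'3 by (simp add: algebra_simps)
    have s1: "\<bar>x'\<bar> = \<sigma> * x'" using side \<sigma> unfolding a'3 by auto
    have "u * (\<sigma> * x') \<ge> 0" using side u(1) unfolding a'3 by simp
    then have s2: "\<bar>\<sigma> + u * (x' - \<sigma>)\<bar> = 1 + u * (\<sigma> * x' - 1)"
      using \<sigma> u by (auto simp: algebra_simps)
    have "hat_dist w = u * hat_dist a'"
      unfolding w3 a'3 using u(1) s1 s2
      by (simp add: abs_mult max_mult_distrib_left algebra_simps)
    moreover have "1 - \<bar>fst w\<bar> = u * (1 - \<bar>x'\<bar>)"
      unfolding w3 fst_conv s1 s2 by (simp add: algebra_simps)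
    moreover have "u * (1 - \<bar>x'\<bar>) \<le> u * 1"
      using u(1) by (intro mult_left_mono) auto
    ultimately show "hat_dist a' * (1 - \<bar>fst w\<bar>) \<le> hat_dist w"
      using pos by (simp add: mult.commute)
  qed
  moreover have "avoidable (closed_segment a' a)"
  proof (rule avoidable_disjoint)
    fix w assume w: "w \<in> closed_segment a' a"
    show "hat_dist w \<noteq> 0"
    proof
      assume "hat_dist w = 0"
      then have "P \<in> closed_segment a' a" using zero_P w split by blast
      then obtain u where u: "0 \<le> u" "u \<le> 1" "P = (1 - u) *\<^sub>R a' + u *\<^sub>R a"
        unfolding in_segment by blast
      have "(1 - u) *\<^sub>R a' + u *\<^sub>R a - P = (\<mu> + u * (1 - \<mu>)) *\<^sub>R (a - P)"
        unfolding a'_def by (simp add: algebra_simps)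
      then have "(\<mu> + u * (1 - \<mu>)) *\<^sub>R (a - P) = 0" using u(3) by simp
      moreover have "\<mu> + u * (1 - \<mu>) > 0" using \<mu> u by (simp add: add_pos_nonneg)
      ultimately show False using a unfolding P_def by simp
    qed
  qed simp
  ultimately show ?thesis unfolding P_def[symmetric] split by (rule avoidable_Un)
qed

text \<open>The segment may run through a base vertex in its interior. Cutting it there leaves two
  pieces that start at a corner; without a zero of \<open>hat_dist\<close>, compactness
  suffices.\<close>

lemma avoidable_segment:
  assumes disj: "\<And>w. w \<in> closed_segment a b \<Longrightarrow> hat_dist w = 0 \<Longrightarrow> w = (1, 0, 0) \<or> w = (-1, 0, 0)"
  shows "avoidable (closed_segment a b)"
proof -
  have corner: "avoidable (closed_segment a b)"
    if \<sigma>: "\<sigma> = 1 \<or> \<sigma> = -1" and P: "(\<sigma>, 0, 0) \<in> closed_segment a b" for \<sigma>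
  proof -
    let ?P = "(\<sigma>, 0, 0) :: point3"
    have split: "closed_segment a b = closed_segment ?P a \<union> closed_segment ?P b"
      using Un_closed_segment[OF P] by (simp add: closed_segment_commute)
    have half: "avoidable (closed_segment ?P c)" if "c \<noteq> ?P" "closed_segment ?P c \<subseteq> closed_segment a b" for c
      using avoidable_from_corner[OF \<sigma> that(1)] disj that(2) by blast
    consider "a = ?P" "b = ?P" | "a = ?P" "b \<noteq> ?P" | "a \<noteq> ?P" "b = ?P" | "a \<noteq> ?P" "b \<noteq> ?P" by blast
    then show ?thesis
    proof cases
      case 1
      then show ?thesis
        using \<sigma> unfolding avoidable_def by (intro exI[of _ 1]) auto
    next
      case 2
      then show ?thesis using half[of b] by simp
    next
      case 3
      then show ?thesis using half[of a] by (simp add: closed_segment_commute)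
    next
      case 4
      then show ?thesis unfolding split using half[of a] half[of b] split by (blast intro: avoidable_Un)
    qed
  qed
  show ?thesis
  proof (cases "\<exists>w\<in>closed_segment a b. hat_dist w = 0")
    case True
    then show ?thesis using disj corner[of 1] corner[of "-1"] by fastforce
  next
    case False
    then show ?thesis by (intro avoidable_disjoint) auto
  qed
qed

section \<open>The triangle move\<close>

lemma triangle_move_standard:
  assumes R: "segment_union R"
    and disj: "\<And>w. w \<in> R \<Longrightarrow> hat_dist w = 0 \<Longrightarrow> w = (1, 0, 0) \<or> w = (-1, 0, 0)"
  shows "equivalent_knots (closed_segment (-1, 0, 0) (1, 0, 0) \<union> R)
           (closed_segment (-1, 0, 0) (0, 1, 0) \<union> closed_segment (0, 1, 0) (1, 0, 0) \<union> R)"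
proof -
  have "avoidable R"
  proof -
    obtain S where S: "finite S" "R = (\<Union>(a, b)\<in>S. closed_segment a b)"
      using R unfolding segment_union_def by blast
    show ?thesis
      unfolding S(2)
    proof (rule avoidable_UN[OF S(1)])
      fix i assume i: "i \<in> S"
      obtain a b where ab: "i = (a, b)" by (cases i)
      have "w \<in> R" if "w \<in> closed_segment a b" for w
        using i that unfolding S(2) ab by blast
      then have "avoidable (closed_segment a b)"
        by (intro avoidable_segment disj)
      then show "avoidable (case i of (a, b) \<Rightarrow> closed_segment a b)"
        unfolding ab by simp
    qed
  qed
  then obtain e where e: "e > 0" "\<And>w. w \<in> R \<Longrightarrow> e * (1 - \<bar>fst w\<bar>) \<le> hat_dist w"
    unfolding avoidable_def by blast
  have fix_R: "push e 1 ` R = R"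
  proof -
    have "push e 1 w = w" if "w \<in> R" for w
      using bump_eq_0[OF e(1) e(2)[OF that]] by (simp add: push_eq)
    then show ?thesis by force
  qed
  have push_base: "push e 1 (x, 0, 0) = (x, 1 - \<bar>x\<bar>, 0)" if "\<bar>x\<bar> \<le> 1" for x
    using that by simp
  have base: "closed_segment (-1, 0, 0) (1, 0, 0) = (\<lambda>x. (x, 0, 0) :: point3) ` {-1..1}"
  proof safe
    fix x y z :: real assume "(x, y, z) \<in> closed_segment (-1, 0, 0) (1, 0, 0)"
    then show "(x, y, z) \<in> (\<lambda>x. (x, 0, 0)) ` {-1..1}" unfolding in_segment by auto
  next
    fix x :: real assume "x \<in> {-1..1}"
    then show "(x, 0, 0) \<in> closed_segment (-1, 0, 0) (1, 0, 0 :: real)"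
      unfolding in_segment by (intro exI[of _ "(1 + x) / 2"]) (auto simp: field_simps)
  qed
  have "(\<lambda>x. (x, 1 - \<bar>x\<bar>, 0) :: point3) ` {-1..1} =
      closed_segment (-1, 0, 0) (0, 1, 0) \<union> closed_segment (0, 1, 0) (1, 0, 0)"
  proof safe
    fix x :: real assume x: "x \<in> {-1..1}" "(x, 1 - \<bar>x\<bar>, 0) \<notin> closed_segment (0, 1, 0) (1, 0, 0 :: real)"
    have "x \<le> 0"
    proof (rule ccontr)
      assume "\<not> x \<le> 0"
      then have "(x, 1 - \<bar>x\<bar>, 0) \<in> closed_segment (0, 1, 0) (1, 0, 0 :: real)"
        using x(1) unfolding in_segment by (intro exI[of _ x]) (auto simp: field_simps)
      with x(2) show False by simp
    qed
    then show "(x, 1 - \<bar>x\<bar>, 0) \<in> closed_segment (-1, 0, 0) (0, 1, 0 :: real)"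
      using x(1) unfolding in_segment by (intro exI[of _ "1 + x"]) (auto simp: field_simps)
  next
    fix x y z :: real assume "(x, y, z) \<in> closed_segment (-1, 0, 0) (0, 1, 0)"
    then show "(x, y, z) \<in> (\<lambda>x. (x, 1 - \<bar>x\<bar>, 0)) ` {-1..1}" unfolding in_segment by auto
  next
    fix x y z :: real assume "(x, y, z) \<in> closed_segment (0, 1, 0) (1, 0, 0)"
    then show "(x, y, z) \<in> (\<lambda>x. (x, 1 - \<bar>x\<bar>, 0)) ` {-1..1}" unfolding in_segment by auto
  qed
  moreover have "push e 1 ` closed_segment (-1, 0, 0) (1, 0, 0) = (\<lambda>x. (x, 1 - \<bar>x\<bar>, 0)) ` {-1..1}"
    unfolding base image_image by (rule image_cong[OF refl]) (simp add: push_base abs_le_iff del: push.simps)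
  ultimately show ?thesis
    using push_isotopy[OF e(1), of "closed_segment (-1, 0, 0) (1, 0, 0) \<union> R"]
    by (simp add: image_Un fix_R)
qed

text \<open>An affine map takes the standard triangle to p, r, q: \<open>u\<close> is half the base,
  \<open>v\<close> leads from the midpoint of the base to the apex, and \<open>n\<close> is any
  vector outside their plane. The hypothesis \<open>indep\<close> makes the map invertible.\<close>

lemma triangle_move:
  fixes p q r :: point3
  assumes indep: "\<And>x y. x *\<^sub>R (r - p) + y *\<^sub>R (q - p) = 0 \<Longrightarrow> x = 0 \<and> y = 0"
    and R: "segment_union R"
    and disj: "convex hull {p, q, r} \<inter> R \<subseteq> {p, r}"
  shows "equivalent_knots (closed_segment p r \<union> R) (closed_segment p q \<union> closed_segment q r \<union> R)"
proof -
  define m where "m = (1/2) *\<^sub>R (p + r)"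
  define u where "u = (1/2) *\<^sub>R (r - p)"
  define v where "v = q - m"
  have "dim (span {u, v}) \<le> 2"
    using dim_le_card'[of "{u, v}"] card_insert_le_m1[of 2 "{v}" u] by (simp add: dim_span)
  then have "dim (span {u, v}) < dim (UNIV :: point3 set)"
    by (simp del: dim_span)
  then have "span {u, v} \<noteq> (UNIV :: point3 set)"
    by (metis less_irrefl)
  then obtain n where n: "n \<notin> span {u, v}" by blast
  define f where "f = (\<lambda>(x, y, z). x *\<^sub>R u + y *\<^sub>R v + z *\<^sub>R n)"
  define \<phi> where "\<phi> w = m + f w" for w
  have "linear f"
    unfolding f_def by (rule linearI) (auto simp: algebra_simps)
  have "inj f"
    unfolding linear_injective_0[OF \<open>linear f\<close>]
  proof (intro allI impI)
    fix w assume fw: "f w = 0"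
    obtain x y z where w: "w = (x, y, z)" by (cases w)
    have eq: "x *\<^sub>R u + y *\<^sub>R v + z *\<^sub>R n = 0" using fw unfolding w f_def by simp
    have "z = 0"
    proof (rule ccontr)
      assume "z \<noteq> 0"
      have "n = (1 / z) *\<^sub>R (z *\<^sub>R n)" using \<open>z \<noteq> 0\<close> by simp
      also have "z *\<^sub>R n = - (x *\<^sub>R u + y *\<^sub>R v)"
        using minus_unique[OF eq] by simp
      also have "(1 / z) *\<^sub>R - (x *\<^sub>R u + y *\<^sub>R v) \<in> span {u, v}"
        by (intro span_mul span_neg span_add span_base) auto
      finally show False using n by blast
    qed
    \<comment> \<open>Because \<open>v\<close> equals (q - p) - (r - p)/2, a relation between
      \<open>u\<close> and \<open>v\<close> is one between the two sides at p.\<close>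
    have "(x / 2 - y / 2) *\<^sub>R (r - p) + y *\<^sub>R (q - p) = x *\<^sub>R u + y *\<^sub>R v"
      unfolding u_def v_def m_def by (simp add: prod_eq_iff algebra_simps add_divide_distrib diff_divide_distrib)
    with eq \<open>z = 0\<close> have "(x / 2 - y / 2) *\<^sub>R (r - p) + y *\<^sub>R (q - p) = 0" by simp
    then show "w = 0" using indep[of "x / 2 - y / 2" y] \<open>z = 0\<close> unfolding w by (auto simp: zero_prod_def)
  qed
  have "surj f"
    using linear_inj_imp_surj[OF \<open>linear f\<close> \<open>inj f\<close>] .
  have \<phi>: "selfhomeo \<phi>"
  proof (rule selfhomeo_bij)
    show "continuous_on UNIV \<phi>"
      unfolding \<phi>_def using linear_continuous_on[of f] \<open>linear f\<close> by (intro continuous_intros) (simp add: linear_conv_bounded_linear)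
    show "inj \<phi>" using \<open>inj f\<close> unfolding \<phi>_def inj_def by simp
    show "surj \<phi>" unfolding surj_def \<phi>_def
    proof
      fix w
      obtain w' where "w - m = f w'" using \<open>surj f\<close> by blast
      then show "\<exists>w'. w = m + f w'" by (intro exI[of _ w']) (simp add: algebra_simps)
    qed
  qed
  then obtain \<psi> where \<psi>: "homeomorphism UNIV UNIV \<phi> \<psi>" unfolding selfhomeo_def by blast
  have segs: "\<phi> ` closed_segment a b = closed_segment (\<phi> a) (\<phi> b)" for a b
    unfolding \<phi>_def[abs_def] closed_segment_translation closed_segment_linear_image[OF \<open>linear f\<close>]
    by (simp add: image_image)
  have corners: "\<phi> (-1, 0, 0) = p" "\<phi> (1, 0, 0) = r" "\<phi> (0, 1, 0) = q"
    unfolding \<phi>_def f_def u_def v_def m_def by (simp_all add: prod_eq_iff field_simps)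
  have \<phi>\<psi>: "\<phi> (\<psi> w) = w" "\<psi> (\<phi> w) = w" for w
    using homeomorphism_apply1[OF \<psi>] homeomorphism_apply2[OF \<psi>] by simp_all
  have segs': "\<psi> ` closed_segment a b = closed_segment (\<psi> a) (\<psi> b)" for a b
  proof -
    have "closed_segment a b = \<phi> ` closed_segment (\<psi> a) (\<psi> b)"
      by (simp add: segs \<phi>\<psi>)
    then show ?thesis by (simp add: image_image \<phi>\<psi>)
  qed
  have hull: "\<phi> w \<in> convex hull {p, q, r}" if "hat_dist w = 0" for w
  proof -
    obtain x y z where w: "w = (x, y, z)" by (cases w)
    have z: "z = 0" "0 \<le> y" "y \<le> 1 - \<bar>x\<bar>"
      using that unfolding w by (auto simp: max_def split: if_splits)
    have "\<phi> w = ((1 - y - x) / 2) *\<^sub>R p + y *\<^sub>R q + ((1 - y + x) / 2) *\<^sub>R r"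
      unfolding w \<phi>_def f_def u_def v_def m_def
      by (simp add: prod_eq_iff z) (simp add: algebra_simps add_divide_distrib diff_divide_distrib)
    moreover have "(1 - y - x) / 2 \<ge> 0" "(1 - y + x) / 2 \<ge> 0" "(1 - y - x) / 2 + y + (1 - y + x) / 2 = 1"
      using z by (auto simp: field_simps)
    ultimately show ?thesis unfolding convex_hull_3 using z(2) by blast
  qed
  have "equivalent_knots (closed_segment (-1, 0, 0) (1, 0, 0) \<union> \<psi> ` R)
           (closed_segment (-1, 0, 0) (0, 1, 0) \<union> closed_segment (0, 1, 0) (1, 0, 0) \<union> \<psi> ` R)"
  proof (rule triangle_move_standard)
    show "segment_union (\<psi> ` R)" using segment_union_image[OF R segs'] .
    fix w assume w: "w \<in> \<psi> ` R" "hat_dist w = 0"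
    then have "\<phi> w \<in> R" by (auto simp: \<phi>\<psi>)
    then have "\<phi> w = p \<or> \<phi> w = r" using hull[OF w(2)] disj by blast
    then show "w = (1, 0, 0) \<or> w = (-1, 0, 0)" by (metis corners(1,2) \<phi>\<psi>(2))
  qed
  from equivalent_knots_image[OF this \<psi>] show ?thesis
    by (simp add: image_Un segs corners image_image \<phi>\<psi>)
qed

section \<open>Moving an arc below the rest of the knot\<close>

definition shadow :: "point3 \<Rightarrow> real \<times> real" where
  "shadow w = (fst w, fst (snd w))"

definition height :: "point3 \<Rightarrow> real" where
  "height w = snd (snd w)"

text \<open>The number h is a depth: the image has height - h, so a larger h is further below the
  knot.\<close>

definition drop_to :: "real \<Rightarrow> point3 \<Rightarrow> point3" where
  "drop_to h w = (fst w, fst (snd w), - h)"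

lemma shadow_linear [simp]:
  "shadow (v + w) = shadow v + shadow w" "shadow (c *\<^sub>R w) = c *\<^sub>R shadow w" "shadow (v - w) = shadow v - shadow w"
  by (simp_all add: shadow_def)

lemma height_linear [simp]:
  "height (v + w) = height v + height w" "height (c *\<^sub>R w) = c * height w" "height (v - w) = height v - height w"
  by (simp_all add: height_def)

lemma drop_to_simps [simp]: "shadow (drop_to h w) = shadow w" "height (drop_to h w) = - h"
  by (simp_all add: drop_to_def shadow_def height_def)

fun plane_simple :: "point3 list \<Rightarrow> bool" where
  "plane_simple (p # q # ps) \<longleftrightarrow>
     shadow p \<noteq> shadow q \<and>
     (\<forall>w\<in>closed_segment p q. \<forall>w'\<in>polyline (q # ps). shadow w = shadow w' \<longrightarrow> w = q \<and> w' = q) \<and>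
     plane_simple (q # ps)"
| "plane_simple ps \<longleftrightarrow> True"

definition lies_under :: "point3 set \<Rightarrow> point3 set \<Rightarrow> point3 set \<Rightarrow> bool" where
  "lies_under E A R \<longleftrightarrow>
     (\<forall>w\<in>A. \<forall>w'\<in>R. shadow w = shadow w' \<longrightarrow> height w < height w' \<or> w = w' \<and> w \<in> E)"

text \<open>The vertical curtain hanging from the edge p q down to depth h. It is convex, so any
  triangle with vertices on it stays inside; and whatever meets the curtain lies at or below a point
  of the edge, which \<open>lies_under\<close> forbids away from the endpoints of the arc.\<close>

definition wall :: "real \<Rightarrow> point3 \<Rightarrow> point3 \<Rightarrow> point3 set" where
  "wall h p q = {w. \<exists>v\<in>closed_segment p q. shadow w = shadow v \<and> - h \<le> height w \<and> height w \<le> height v}"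

lemma convex_wall: "convex (wall h p q)"
proof (rule convexI)
  fix x y :: point3 and u v :: real
  assume x: "x \<in> wall h p q" and y: "y \<in> wall h p q" and uv: "0 \<le> u" "0 \<le> v" "u + v = 1"
  obtain x' where x': "x' \<in> closed_segment p q" "shadow x = shadow x'" "- h \<le> height x" "height x \<le> height x'"
    using x unfolding wall_def by blast
  obtain y' where y': "y' \<in> closed_segment p q" "shadow y = shadow y'" "- h \<le> height y" "height y \<le> height y'"
    using y unfolding wall_def by blast
  have "u *\<^sub>R x' + v *\<^sub>R y' \<in> closed_segment p q"
    by (rule convexD[OF convex_closed_segment x'(1) y'(1) uv])
  moreover have "u * - h + v * - h \<le> u * height x + v * height y"
    using uv x'(3) y'(3) by (intro add_mono mult_left_mono) auto
  moreover have "u * - h + v * - h = - h"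
    using uv(3) by (metis distrib_right mult_1)
  moreover have "u * height x + v * height y \<le> u * height x' + v * height y'"
    using uv x'(4) y'(4) by (intro add_mono mult_left_mono) auto
  ultimately show "u *\<^sub>R x + v *\<^sub>R y \<in> wall h p q"
    unfolding wall_def using x'(2) y'(2) by (intro CollectI bexI[of _ "u *\<^sub>R x' + v *\<^sub>R y'"]) auto
qed

lemma hull_subset_wall:
  assumes "{a, b, c} \<subseteq> wall h p q"
  shows "convex hull {a, b, c} \<subseteq> wall h p q"
  using assms convex_wall by (rule hull_minimal)

lemma wall_corner:
  assumes "v = p \<or> v = q" "shadow w = shadow v" "- h \<le> height w" "height w \<le> height v"
  shows "w \<in> wall h p q"
  unfolding wall_def using assms by auto

lemma indep_fan:
  assumes "shadow p = shadow p'" "height p \<noteq> height p'" "shadow q \<noteq> shadow p"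
    and "x *\<^sub>R (q - p) + y *\<^sub>R (p' - p) = 0"
  shows "x = 0 \<and> y = 0"
proof -
  have "shadow (x *\<^sub>R (q - p) + y *\<^sub>R (p' - p)) = 0" "height (x *\<^sub>R (q - p) + y *\<^sub>R (p' - p)) = 0"
    unfolding assms(4) by (simp_all add: shadow_def height_def zero_prod_def)
  then show ?thesis using assms(1-3) by auto
qed

lemma triangle_move_fan:
  assumes "shadow p = shadow p'" "height p \<noteq> height p'" "shadow q \<noteq> shadow p" "segment_union R"
    and "convex hull {p, p', q} \<inter> R \<subseteq> {p, q}"
  shows "equivalent_knots (closed_segment p q \<union> R) (closed_segment p p' \<union> closed_segment p' q \<union> R)"
  by (rule triangle_move) (use assms indep_fan[OF assms(1-3)] in auto)

lemma segment_height:
  assumes "w \<in> closed_segment p q"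
  shows "height p \<le> c \<Longrightarrow> height q \<le> c \<Longrightarrow> height w \<le> c"
    and "c \<le> height p \<Longrightarrow> c \<le> height q \<Longrightarrow> c \<le> height w"
    and "height p < c \<Longrightarrow> height q \<le> c \<Longrightarrow> height w = c \<Longrightarrow> w = q"
    and "c < height p \<Longrightarrow> c \<le> height q \<Longrightarrow> height w = c \<Longrightarrow> w = q"
proof -
  obtain u where u: "0 \<le> u" "u \<le> 1" "w = (1 - u) *\<^sub>R p + u *\<^sub>R q"
    using assms unfolding in_segment by blast
  have h: "height w = (1 - u) * height p + u * height q" unfolding u(3) by simp
  have "(1 - u) * height p + u * height q \<le> c" if "height p \<le> c" "height q \<le> c"
    using convex_bound_le[OF that, of "1 - u" u] u by simp
  then show "height p \<le> c \<Longrightarrow> height q \<le> c \<Longrightarrow> height w \<le> c" using h by simp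
  have "(1 - u) * - height p + u * - height q \<le> - c" if "c \<le> height p" "c \<le> height q"
    using convex_bound_le[of "- height p" "- c" "- height q" "1 - u" u] u that by simp
  then show "c \<le> height p \<Longrightarrow> c \<le> height q \<Longrightarrow> c \<le> height w" using h by simp
  have end_point: "w = q" if "u = 1" using that u(3) by simp
  have eq: "height w - c = (1 - u) * (height p - c) + u * (height q - c)"
    unfolding h by (simp add: algebra_simps)
  show "w = q" if "height p < c" "height q \<le> c" "height w = c"
  proof (rule end_point, rule ccontr)
    assume "u \<noteq> 1"
    then have "(1 - u) * (height p - c) < 0" using u that by (simp add: mult_pos_neg)
    moreover have "u * (height q - c) \<le> 0" using u that by (simp add: mult_nonneg_nonpos)
    ultimately show False using eq that(3) by simp
  qed
  show "w = q" if "c < height p" "c \<le> height q" "height w = c"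
  proof (rule end_point, rule ccontr)
    assume "u \<noteq> 1"
    then have "(1 - u) * (height p - c) > 0" using u that by simp
    moreover have "u * (height q - c) \<ge> 0" using u that by simp
    ultimately show False using eq that(3) by simp
  qed
qed

lemma segment_shadow:
  assumes "w \<in> closed_segment p q" "shadow p = c" "shadow q = c"
  shows "shadow w = c"
proof -
  obtain u where u: "w = (1 - u) *\<^sub>R p + u *\<^sub>R q" using assms(1) unfolding in_segment by blast
  show ?thesis unfolding u using assms(2,3) by (simp flip: scaleR_left_distrib)
qed

text \<open>If such a combination gave positive weight to b and c, cancelling the weight of a would
  leave a point of the segment b c over a.\<close>

lemma hull_over_vertex:
  assumes "w \<in> convex hull {a, b, c}" "shadow w = shadow a"
    and "\<And>v. v \<in> closed_segment b c \<Longrightarrow> shadow v \<noteq> shadow a"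
  shows "w = a"
proof -
  obtain x y z where w: "w = x *\<^sub>R a + y *\<^sub>R b + z *\<^sub>R c" "0 \<le> x" "0 \<le> y" "0 \<le> z" "x + y + z = 1"
    using assms(1) unfolding convex_hull_3 by blast
  have "y + z = 0"
  proof (rule ccontr)
    assume nz: "y + z \<noteq> 0"
    define v where "v = (1 / (y + z)) *\<^sub>R (y *\<^sub>R b + z *\<^sub>R c)"
    have "v \<in> closed_segment b c"
      unfolding in_segment v_def using w nz
      by (intro exI[of _ "z / (y + z)"]) (simp add: scaleR_add_right field_simps)
    moreover have "shadow w = x *\<^sub>R shadow a + (y + z) *\<^sub>R shadow v"
      unfolding w(1) v_def using nz by (simp add: scaleR_add_right)
    then have "(1 - x) *\<^sub>R shadow a = (y + z) *\<^sub>R shadow v"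
      using assms(2) by (simp add: algebra_simps)
    then have "(y + z) *\<^sub>R shadow a = (y + z) *\<^sub>R shadow v" using w(5) by (metis add_diff_cancel_left' group_cancel.add1)
    then have "shadow v = shadow a" using nz by simp
    ultimately show False using assms(3) by blast
  qed
  then have "y = 0" "z = 0" "x = 1" using w by auto
  then show ?thesis using w(1) by simp
qed

lemma last_in_polyline: "last (q # r # ps) \<in> polyline (q # r # ps)"
proof (induction "q # r # ps" arbitrary: q r ps rule: polyline.induct)
  case (1 q r ps)
  then show ?case by (cases ps) auto
qed

lemma compact_polyline: "compact (polyline ps)"
  by (induction ps rule: polyline.induct) auto

lemma segment_union_compact: "segment_union R \<Longrightarrow> compact R"
  unfolding segment_union_def by (auto intro!: compact_UN)

lemma bounded_below_height:
  assumes "compact K"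
  obtains h where "\<And>w. w \<in> K \<Longrightarrow> - h < height w"
proof -
  have "compact (height ` K)"
    using assms unfolding height_def[abs_def] by (intro compact_continuous_image continuous_intros)
  then obtain b where "\<And>w. w \<in> K \<Longrightarrow> \<bar>height w\<bar> \<le> b"
    using compact_imp_bounded[of "height ` K"] unfolding bounded_iff by auto
  then have "- (b + 1) < height w" if "w \<in> K" for w using that by fastforce
  then show thesis by (rule that)
qed

lemma vertices_in_polyline: "length ps \<ge> 2 \<Longrightarrow> set ps \<subseteq> polyline ps"
proof (induction ps rule: polyline.induct)
  case (1 p q ps)
  then show ?case by (cases ps) auto
qed auto

lemma polyline_subset: "convex S \<Longrightarrow> set ps \<subseteq> S \<Longrightarrow> polyline ps \<subseteq> S"
  by (induction ps rule: polyline.induct) (auto dest: closed_segment_subset)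

lemma convex_height: "convex {w. c < height w}" "convex {w. height w \<le> c}"
proof -
  have "{w. c < height w} = {w. (0, 0, 1) \<bullet> w > c}" "{w. height w \<le> c} = {w. (0, 0, 1) \<bullet> w \<le> c}"
    by (auto simp: height_def inner_prod_def)
  then show "convex {w. c < height w}" "convex {w. height w \<le> c}"
    by (simp_all add: convex_halfspace_le convex_halfspace_gt)
qed

text \<open>An arc below the rest of the knot can be pulled down, edge by edge, into a plane below everything
  else, where it is straightened; the result depends on its endpoints only. The already straightened part
  starts at a greater depth, so that it stays out of the way of the next edge.\<close>

lemma straighten_lowered:
  assumes "segment_union R" "\<And>w. w \<in> R \<Longrightarrow> - h < height w" "\<And>w. w \<in> set (p # ps) \<Longrightarrow> - h < height w"
    and "plane_simple (p # ps)" "\<And>w. w \<in> polyline (p # ps) \<Longrightarrow> shadow w \<noteq> shadow P"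
    and "shadow p \<noteq> shadow P" "- h < height P"
    and "lies_under {last (p # ps)} (polyline (p # ps)) R"
  shows "equivalent_knots
    (closed_segment P (drop_to (h + 1) P) \<union> closed_segment (drop_to (h + 1) P) (drop_to h p) \<union>
     closed_segment (drop_to h p) p \<union> polyline (p # ps) \<union> R)
    (closed_segment P (drop_to (h + 1) P) \<union> closed_segment (drop_to (h + 1) P) (drop_to h (last (p # ps))) \<union>
     closed_segment (drop_to h (last (p # ps))) (last (p # ps)) \<union> R)"
  using assms(3-)
proof (induction ps arbitrary: p)
  case Nil
  then show ?case by (simp add: equivalent_knots_refl)
next
  case (Cons q ps)
  define P' where "P' = drop_to (h + 1) P"
  define p' where "p' = drop_to h p"
  define q' where "q' = drop_to h q"
  define T where "T = polyline (q # ps)"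
  have hp: "- h < height p" "- h < height q" using Cons.prems(1) by auto
  have pq: "shadow p \<noteq> shadow q" using Cons.prems(2) by simp
  have edge_T: "w' = q" if "w \<in> closed_segment p q" "w' \<in> T" "shadow w = shadow w'" for w w'
    using Cons.prems(2) that unfolding T_def by auto
  have edge_P: "shadow w \<noteq> shadow P" if "w \<in> closed_segment p q" for w
    using Cons.prems(3) that by simp
  have edge_R: "height w < height w'  \<or> w' = q" if w: "w \<in> closed_segment p q" and w': "w' \<in> R" "shadow w = shadow w'" for w w'
  proof -
    have "height w < height w' \<or> w = w' \<and> w = last (p # q # ps)"
      using Cons.prems(6) that unfolding lies_under_def by auto
    \<comment> \<open>The arc has a simple projection, so its endpoint can lie on the current edge
      only as the endpoint q of this edge.\<close>
    moreover have "w = q" if "w = last (p # q # ps)"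
    proof (cases ps)
      case (Cons r rs)
      then have "w \<in> T" using that last_in_polyline[of q r rs] unfolding T_def by simp
      then show ?thesis using edge_T[OF w] by simp
    qed (use that in simp)
    ultimately show ?thesis by blast
  qed
  have T_high: "- h < height w" if "w \<in> T" for w
  proof -
    have "set (q # ps) \<subseteq> {w. - h < height w}"
      using Cons.prems(1) by (intro subsetI CollectI) (metis list.set_intros(2))
    from polyline_subset[OF convex_height(1) this] show ?thesis
      using that unfolding T_def by blast
  qed
  have wall_rest: "wall h p q \<inter> (closed_segment P P' \<union> closed_segment P' p' \<union> T \<union> R) \<subseteq> {p', q}"
  proof
    fix w assume w: "w \<in> wall h p q \<inter> (closed_segment P P' \<union> closed_segment P' p' \<union> T \<union> R)"
    obtain v where v: "v \<in> closed_segment p q" "shadow w = shadow v" "- h \<le> height w" "height w \<le> height v"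
      using w unfolding wall_def by blast
    consider "w \<in> closed_segment P P'" | "w \<in> closed_segment P' p'" | "w \<in> T" | "w \<in> R" using w by blast
    then show "w \<in> {p', q}"
    proof cases
      case 1
      then have "shadow w = shadow P" by (rule segment_shadow) (simp_all add: P'_def)
      then show ?thesis using edge_P[OF v(1)] v(2) by simp
    next
      case 2
      have "height w \<le> - h" using 2 by (rule segment_height(1)) (simp_all add: P'_def p'_def)
      then have "w = p'" using segment_height(3)[OF 2, of "- h"] v(3) by (simp add: P'_def p'_def)
      then show ?thesis by simp
    next
      case 3
      then show ?thesis using edge_T[OF v(1)] v(2) by simp
    next
      case 4
      then show ?thesis using edge_R[OF v(1), of w] v(2,4) by auto
    qed
  qed
  have corners: "p \<in> wall h p q" "q \<in> wall h p q" "p' \<in> wall h p q" "q' \<in> wall h p q"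
    using hp wall_corner[of p p q _ h] wall_corner[of q p q _ h] by (simp_all add: p'_def q'_def)
  let ?rest = "closed_segment P P' \<union> closed_segment P' p' \<union> T \<union> R"
  have seg: "segment_union ?rest" using assms(1) unfolding T_def by simp
  \<comment> \<open>The path P' p' p q is changed in three triangle moves: p' p q becomes p' q, then
    p' q' q, and finally P' p' q' becomes P' q'. The first two triangles lie in the curtain of p q,
    the third at heights at most - h.\<close>
  have 1: "equivalent_knots (closed_segment p' q \<union> ?rest) (closed_segment p' p \<union> closed_segment p q \<union> ?rest)"
    using hp pq seg hull_subset_wall[of p' p q h p q] corners wall_rest
    by (intro triangle_move_fan) (auto simp: p'_def)
  have 2: "equivalent_knots (closed_segment q p' \<union> ?rest) (closed_segment q q' \<union> closed_segment q' p' \<union> ?rest)"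
    using hp pq seg hull_subset_wall[of q q' p' h p q] corners wall_rest
    by (intro triangle_move_fan) (auto simp: p'_def q'_def)
  let ?rest' = "closed_segment P P' \<union> closed_segment q' q \<union> T \<union> R"
  \<comment> \<open>Everything in the rest except P P' stays at or above height - h and reaches that
    height at q' only, while P P' can meet the triangle only at its vertex P'.\<close>
  have 3: "equivalent_knots (closed_segment P' q' \<union> ?rest') (closed_segment P' p' \<union> closed_segment p' q' \<union> ?rest')"
  proof (rule triangle_move)
    show "segment_union ?rest'" using assms(1) unfolding T_def by simp
    show "x = 0 \<and> y = 0" if "x *\<^sub>R (q' - P') + y *\<^sub>R (p' - P') = 0" for x y
    proof -
      have sh: "shadow (x *\<^sub>R (q' - P') + y *\<^sub>R (p' - P')) = 0" and "height (x *\<^sub>R (q' - P') + y *\<^sub>R (p' - P')) = 0"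
        unfolding that by (simp_all add: shadow_def height_def zero_prod_def)
      then have y: "y = - x" by (simp add: P'_def p'_def q'_def)
      then have "x *\<^sub>R (shadow q - shadow p) = 0" using sh by (simp add: P'_def p'_def q'_def algebra_simps)
      then show ?thesis using pq y by simp
    qed
    show "convex hull {P', p', q'} \<inter> ?rest' \<subseteq> {P', q'}"
    proof
      fix w assume w: "w \<in> convex hull {P', p', q'} \<inter> ?rest'"
      have "convex hull {P', p', q'} \<subseteq> {w. height w \<le> - h}"
        by (rule hull_minimal) (simp_all add: P'_def p'_def q'_def convex_height)
      then have low: "height w \<le> - h" using w by blast
      consider "w \<in> closed_segment P P'" | "w \<in> closed_segment q' q" | "w \<in> T" | "w \<in> R" using w by blast
      then show "w \<in> {P', q'}"
      proof cases
        case 1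
        then have sw: "shadow w = shadow P'" by (rule segment_shadow) (simp_all add: P'_def)
        have "w = P'"
        proof (rule hull_over_vertex[OF _ sw])
          show "w \<in> convex hull {P', p', q'}" using w by blast
          fix v assume v: "v \<in> closed_segment p' q'"
          then obtain u where u: "0 \<le> u" "u \<le> 1" "v = (1 - u) *\<^sub>R p' + u *\<^sub>R q'" unfolding in_segment by blast
          then have "(1 - u) *\<^sub>R p + u *\<^sub>R q \<in> closed_segment p q" unfolding in_segment by blast
          from edge_P[OF this] show "shadow v \<noteq> shadow P'" unfolding u(3) by (simp add: p'_def q'_def P'_def)
        qed
        then show ?thesis by simp
      next
        case 2
        then have "w \<in> closed_segment q q'" by (simp add: closed_segment_commute)
        moreover have "- h \<le> height w" using hp by (intro segment_height(2)[OF 2]) (simp_all add: q'_def)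
        then have "height w = - h" using low by simp
        moreover have "- h < height q" "- h \<le> height q'" using hp by (simp_all add: q'_def)
        ultimately have "w = q'" using segment_height(4) by blast
        then show ?thesis by simp
      next
        case 3
        then show ?thesis using T_high low by fastforce
      next
        case 4
        then show ?thesis using assms(2) low by fastforce
      qed
    qed
  qed
  have 4: "equivalent_knots (closed_segment P P' \<union> closed_segment P' q' \<union> closed_segment q' q \<union> polyline (q # ps) \<union> R)
    (closed_segment P P' \<union> closed_segment P' (drop_to h (last (q # ps))) \<union>
     closed_segment (drop_to h (last (q # ps))) (last (q # ps)) \<union> R)"
    unfolding P'_def q'_def
  proof (rule Cons.IH)
    show "- h < height w" if "w \<in> set (q # ps)" for w using Cons.prems(1) that by simp
    show "plane_simple (q # ps)" using Cons.prems(2) by simp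
    show "shadow w \<noteq> shadow P" if "w \<in> polyline (q # ps)" for w using Cons.prems(3) that by simp
    show "shadow q \<noteq> shadow P" using edge_P[of q] by simp
    show "- h < height P" by fact
    show "lies_under {last (q # ps)} (polyline (q # ps)) R"
      using Cons.prems(6) unfolding lies_under_def by auto
  qed
  have "equivalent_knots (closed_segment P P' \<union> closed_segment P' p' \<union> closed_segment p' p \<union> polyline (p # q # ps) \<union> R)
      (closed_segment p' q \<union> ?rest)"
    using equivalent_knots_sym[OF 1] by (simp add: T_def Un_ac)
  also have "equivalent_knots (closed_segment p' q \<union> ?rest) (closed_segment P' p' \<union> closed_segment p' q' \<union> ?rest')"
    using 2 by (simp add: Un_ac closed_segment_commute)
  also have "equivalent_knots (closed_segment P' p' \<union> closed_segment p' q' \<union> ?rest') (closed_segment P P' \<union> closed_segment P' q' \<union> closed_segment q' q \<union> polyline (q # ps) \<union> R)"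
    using equivalent_knots_sym[OF 3] by (simp add: T_def Un_ac)
  also note 4
  finally show ?case unfolding P'_def p'_def by simp
qed

text \<open>The first edge is treated separately because the arc is attached to the rest at P as
  well. Here P is lowered to depth h + 1, so the curtain has to reach that far, and then q to depth
  h; this is the shape from which \<open>straighten_lowered\<close> continues.\<close>

lemma straighten_under:
  assumes R: "segment_union R" "\<And>w. w \<in> R \<Longrightarrow> - h < height w"
    and A: "\<And>w. w \<in> set (P # q # ps) \<Longrightarrow> - h < height w"
    and simple: "plane_simple (P # q # ps)"
    and under: "lies_under {P, last (q # ps)} (polyline (P # q # ps)) R"
  shows "equivalent_knots (polyline (P # q # ps) \<union> R)
    (closed_segment P (drop_to (h + 1) P) \<union> closed_segment (drop_to (h + 1) P) (drop_to h (last (q # ps))) \<union>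
     closed_segment (drop_to h (last (q # ps))) (last (q # ps)) \<union> R)"
proof -
  define P' where "P' = drop_to (h + 1) P"
  define q' where "q' = drop_to h q"
  define T where "T = polyline (q # ps)"
  have hp: "- h < height P" "- h < height q" using A by auto
  have Pq: "shadow P \<noteq> shadow q" using simple by simp
  have edge_T: "w' = q" if "w \<in> closed_segment P q" "w' \<in> T" "shadow w = shadow w'" for w w'
    using simple that unfolding T_def by auto
  have T_P: "shadow w \<noteq> shadow P" if "w \<in> T" for w
    using simple that Pq unfolding T_def plane_simple.simps by (metis ends_in_segment(1))
  have last_T: "w = q" if w: "w \<in> closed_segment P q" "w = last (q # ps)" for w
  proof (cases ps)
    case (Cons r rs)
    then have "w \<in> T" using that last_in_polyline[of q r rs] unfolding T_def by simp
    then show ?thesis using edge_T[OF w(1)] by simp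
  qed (use that in simp)
  have edge_R: "height w < height w' \<or> w' \<in> {P, q}"
    if w: "w \<in> closed_segment P q" and w': "w' \<in> R" "shadow w = shadow w'" for w w'
  proof -
    have "height w < height w' \<or> w = w' \<and> w \<in> {P, last (q # ps)}"
      using under that unfolding lies_under_def by auto
    then show ?thesis using last_T[OF w] by blast
  qed
  have wall_rest: "wall (h + 1) P q \<inter> (T \<union> R) \<subseteq> {P, q}"
  proof
    fix w assume w: "w \<in> wall (h + 1) P q \<inter> (T \<union> R)"
    obtain v where v: "v \<in> closed_segment P q" "shadow w = shadow v" "height w \<le> height v"
      using w unfolding wall_def by blast
    then show "w \<in> {P, q}" using w edge_T[OF v(1), of w] edge_R[OF v(1), of w] by auto
  qed
  have corners: "P \<in> wall (h + 1) P q" "q \<in> wall (h + 1) P q" "P' \<in> wall (h + 1) P q" "q' \<in> wall (h + 1) P q"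
    using hp wall_corner[of P P q _ "h + 1"] wall_corner[of q P q _ "h + 1"] by (simp_all add: P'_def q'_def)
  have 1: "equivalent_knots (closed_segment P q \<union> (T \<union> R)) (closed_segment P P' \<union> closed_segment P' q \<union> (T \<union> R))"
    using hp Pq R(1) hull_subset_wall[of P P' q "h + 1" P q] corners wall_rest
    by (intro triangle_move_fan) (auto simp: P'_def T_def)
  let ?rest = "closed_segment P P' \<union> T \<union> R"
  have "convex hull {q, q', P'} \<inter> ?rest \<subseteq> {q, P'}"
  proof
    fix w assume w: "w \<in> convex hull {q, q', P'} \<inter> ?rest"
    then have ww: "w \<in> wall (h + 1) P q"
      using hull_subset_wall[of q q' P' "h + 1" P q] corners by blast
    have over_P: "w = P'" if "shadow w = shadow P"
    proof (rule hull_over_vertex)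
      show "w \<in> convex hull {P', q, q'}" using w by (simp add: insert_commute)
      show "shadow w = shadow P'" using that by (simp add: P'_def)
      show "shadow v \<noteq> shadow P'" if "v \<in> closed_segment q q'" for v
        using segment_shadow[OF that, of "shadow q"] Pq by (simp add: q'_def P'_def)
    qed
    show "w \<in> {q, P'}"
    proof (cases "w \<in> closed_segment P P'")
      case True
      then show ?thesis using over_P segment_shadow[OF True, of "shadow P"] by (simp add: P'_def)
    next
      case False
      then have "w \<in> {P, q}" using w ww wall_rest by blast
      then show ?thesis using over_P by auto
    qed
  qed
  then have 2: "equivalent_knots (closed_segment q P' \<union> ?rest) (closed_segment q q' \<union> closed_segment q' P' \<union> ?rest)"
    using hp Pq R(1) by (intro triangle_move_fan) (auto simp: P'_def q'_def T_def)
  have "equivalent_knots (polyline (P # q # ps) \<union> R) (closed_segment P q \<union> (T \<union> R))"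
    by (simp add: T_def Un_ac equivalent_knots_refl)
  also note 1
  also have "equivalent_knots (closed_segment P P' \<union> closed_segment P' q \<union> (T \<union> R))
      (closed_segment P P' \<union> closed_segment P' q' \<union> closed_segment q' q \<union> polyline (q # ps) \<union> R)"
    using 2 by (simp add: T_def Un_ac closed_segment_commute)
  also have "equivalent_knots (closed_segment P P' \<union> closed_segment P' q' \<union> closed_segment q' q \<union> polyline (q # ps) \<union> R)
    (closed_segment P P' \<union> closed_segment P' (drop_to h (last (q # ps))) \<union>
     closed_segment (drop_to h (last (q # ps))) (last (q # ps)) \<union> R)"
    unfolding P'_def q'_def
  proof (rule straighten_lowered)
    show "plane_simple (q # ps)" using simple by simp
    show "shadow w \<noteq> shadow P" if "w \<in> polyline (q # ps)" for w using T_P that unfolding T_def by simp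
    show "shadow q \<noteq> shadow P" using Pq by simp
    show "lies_under {last (q # ps)} (polyline (q # ps)) R"
      unfolding lies_under_def
    proof (intro ballI impI)
      fix w w' assume w: "w \<in> polyline (q # ps)" "w' \<in> R" "shadow w = shadow w'"
      then have "height w < height w' \<or> w = w' \<and> w \<in> {P, last (q # ps)}"
        using under unfolding lies_under_def by simp
      moreover have "w \<noteq> P" using T_P w(1) unfolding T_def by blast
      ultimately show "height w < height w' \<or> w = w' \<and> w \<in> {last (q # ps)}" by blast
    qed
  qed (use R A in simp_all)
  finally show ?thesis unfolding P'_def .
qed

theorem arc_move_under:
  assumes R: "segment_union R"
    and A: "length A \<ge> 2" "plane_simple A" "lies_under {hd A, last A} (polyline A) R"
    and B: "length B \<ge> 2" "plane_simple B" "lies_under {hd A, last A} (polyline B) R"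
    and ends: "hd A = hd B" "last A = last B"
  shows "equivalent_knots (polyline A \<union> R) (polyline B \<union> R)"
proof -
  obtain p q ps where A_eq: "A = p # q # ps" using A(1) by (metis Suc_le_length_iff numeral_2_eq_2)
  obtain p' q' ps' where B_eq: "B = p' # q' # ps'" using B(1) by (metis Suc_le_length_iff numeral_2_eq_2)
  \<comment> \<open>One depth below both arcs and the rest makes the final form \<open>N\<close> the
    same for both. The arcs are never compared with each other and may cross arbitrarily.\<close>
  have "compact (polyline A \<union> polyline B \<union> R)"
    using R by (simp add: compact_polyline segment_union_compact compact_Un)
  then obtain h where h: "\<And>w. w \<in> polyline A \<union> polyline B \<union> R \<Longrightarrow> - h < height w"
    using bounded_below_height by blast
  define N where "N = closed_segment p (drop_to (h + 1) p) \<union> closed_segment (drop_to (h + 1) p) (drop_to h (last A)) \<union>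
     closed_segment (drop_to h (last A)) (last A) \<union> R"
  have hR: "- h < height w" if "w \<in> R" for w using h that by blast
  have lasts: "last A = last (q # ps)" "last A = last (q' # ps')" and pp': "p' = p" "hd A = p"
    using ends unfolding A_eq B_eq by simp_all
  have "equivalent_knots (polyline A \<union> R) N"
    unfolding A_eq N_def last_ConsR[OF list.simps(3)]
  proof (rule straighten_under[OF R hR])
    show "- h < height w" if "w \<in> set (p # q # ps)" for w
      using that vertices_in_polyline[OF A(1)] unfolding A_eq[symmetric] by (intro h) blast
    show "plane_simple (p # q # ps)" using A(2) unfolding A_eq .
    show "lies_under {p, last (q # ps)} (polyline (p # q # ps)) R"
      using A(3) unfolding A_eq by (simp only: list.sel last_ConsR[OF list.simps(3)])
  qed
  moreover have "equivalent_knots (polyline B \<union> R) N"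
    unfolding B_eq N_def lasts(2) pp'(1)[symmetric]
  proof (rule straighten_under[OF R hR])
    show "- h < height w" if "w \<in> set (p' # q' # ps')" for w
      using that vertices_in_polyline[OF B(1)] unfolding B_eq[symmetric] by (intro h) blast
    show "plane_simple (p' # q' # ps')" using B(2) unfolding B_eq .
    show "lies_under {p', last (q' # ps')} (polyline (p' # q' # ps')) R"
      using B(3) unfolding lasts(2) pp'(2) B_eq by (simp only: pp'(1))
  qed
  ultimately show ?thesis
    by (rule equivalent_knots_trans[OF _ equivalent_knots_sym])
qed

section \<open>Checking arc moves on vertex coordinates\<close>

text \<open>The first reflection exchanges left and right, the second exchanges over and under and
  thereby in-moves and out-moves.\<close>

fun mirror_x :: "point3 \<Rightarrow> point3" where "mirror_x (x, y, z) = (- x, y, z)"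
fun mirror_z :: "point3 \<Rightarrow> point3" where "mirror_z (x, y, z) = (x, y, - z)"

lemma mirror_mirror [simp]: "mirror_x (mirror_x w) = w" "mirror_z (mirror_z w) = w"
  by (cases w; simp)+

lemma linear_mirror: "linear mirror_x" "linear mirror_z"
  by (rule linearI; clarsimp)+

lemma homeomorphism_mirror: "homeomorphism UNIV UNIV mirror_x mirror_x" "homeomorphism UNIV UNIV mirror_z mirror_z"
proof -
  have "continuous_on UNIV mirror_x" "continuous_on UNIV mirror_z"
    using linear_mirror by (simp_all add: linear_continuous_on linear_conv_bounded_linear)
  moreover have "surj mirror_x" "surj mirror_z"
    by (metis mirror_mirror surjI)+
  ultimately show "homeomorphism UNIV UNIV mirror_x mirror_x" "homeomorphism UNIV UNIV mirror_z mirror_z"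
    by (simp_all add: homeomorphism_def)
qed

lemma polyline_image:
  assumes "linear f"
  shows "f ` polyline ps = polyline (map f ps)"
  by (induction ps rule: polyline.induct) (simp_all add: image_Un closed_segment_linear_image[OF assms])

lemmas mirror_polyline = linear_mirror[THEN polyline_image]

lemma segment_union_mirror:
  "segment_union R \<Longrightarrow> segment_union (mirror_x ` R)" "segment_union R \<Longrightarrow> segment_union (mirror_z ` R)"
  by (rule segment_union_image; simp add: closed_segment_linear_image linear_mirror)+

lemma equivalent_knots_mirror:
  "equivalent_knots (mirror_x ` K) (mirror_x ` L) \<longleftrightarrow> equivalent_knots K L"
  "equivalent_knots (mirror_z ` K) (mirror_z ` L) \<longleftrightarrow> equivalent_knots K L"
  by (rule equivalent_knots_image_iff, rule homeomorphism_mirror)+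

text \<open>
  Sufficient conditions for the position of the segments \<open>p q\<close> and \<open>r s\<close> that compare coordinates of endpoints
  only. \<open>pinned p q r s\<close>: over a common point of the projections the first segment is at \<open>p\<close>.
\<close>

fun apart :: "point3 \<Rightarrow> point3 \<Rightarrow> point3 \<Rightarrow> point3 \<Rightarrow> bool" where
  "apart (px, py, pz) (qx, qy, qz) (rx, ry, rz) (sx, sy, sz) \<longleftrightarrow>
     px < rx \<and> px < sx \<and> qx < rx \<and> qx < sx \<or> rx < px \<and> rx < qx \<and> sx < px \<and> sx < qx \<or>
     py < ry \<and> py < sy \<and> qy < ry \<and> qy < sy \<or> ry < py \<and> ry < qy \<and> sy < py \<and> sy < qy"

fun lower :: "point3 \<Rightarrow> point3 \<Rightarrow> point3 \<Rightarrow> point3 \<Rightarrow> bool" where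
  "lower (px, py, pz) (qx, qy, qz) (rx, ry, rz) (sx, sy, sz) \<longleftrightarrow>
     pz < rz \<and> pz < sz \<and> qz < rz \<and> qz < sz"

fun pinned :: "point3 \<Rightarrow> point3 \<Rightarrow> point3 \<Rightarrow> point3 \<Rightarrow> bool" where
  "pinned (px, py, pz) (qx, qy, qz) (rx, ry, rz) (sx, sy, sz) \<longleftrightarrow>
     px < qx \<and> rx \<le> px \<and> sx \<le> px \<or> qx < px \<and> px \<le> rx \<and> px \<le> sx \<or>
     py < qy \<and> ry \<le> py \<and> sy \<le> py \<or> qy < py \<and> py \<le> ry \<and> py \<le> sy"

lemma convex_combination_less:
  fixes a b c d u v :: real
  assumes "a < c" "a < d" "b < c" "b < d" "0 \<le> u" "u \<le> 1" "0 \<le> v" "v \<le> 1"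
  shows "(1 - u) * a + u * b < (1 - v) * c + v * d"
proof -
  have "(1 - u) * a + u * b \<le> max a b"
    using assms by (intro convex_bound_le) auto
  moreover have "(1 - v) * - c + v * - d \<le> - min c d"
    using assms by (intro convex_bound_le) auto
  ultimately show ?thesis using assms by (auto simp: max_def min_def split: if_splits)
qed

lemma convex_combination_pinned:
  fixes a b c d u v :: real
  assumes "a < b \<and> c \<le> a \<and> d \<le> a \<or> b < a \<and> a \<le> c \<and> a \<le> d"
    and "0 \<le> u" "u \<le> 1" "0 \<le> v" "v \<le> 1" "(1 - u) * a + u * b = (1 - v) * c + v * d"
  shows "u = 0"
proof (rule ccontr)
  assume "u \<noteq> 0"
  have eq: "u * (b - a) = (1 - v) * (c - a) + v * (d - a)"
    using assms(6) by (simp add: algebra_simps)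
  from assms(1) show False
  proof
    assume *: "a < b \<and> c \<le> a \<and> d \<le> a"
    have "u * (b - a) > 0" using * \<open>u \<noteq> 0\<close> assms(2) by simp
    moreover have "(1 - v) * (c - a) \<le> 0" "v * (d - a) \<le> 0"
      using * assms(4,5) by (auto intro: mult_nonneg_nonpos)
    ultimately show False using eq by linarith
  next
    assume *: "b < a \<and> a \<le> c \<and> a \<le> d"
    have "u * (b - a) < 0" using * \<open>u \<noteq> 0\<close> assms(2) by (simp add: mult_pos_neg)
    moreover have "(1 - v) * (c - a) \<ge> 0" "v * (d - a) \<ge> 0"
      using * assms(4,5) by auto
    ultimately show False using eq by linarith
  qed
qed

lemma segments_cases:
  assumes "w \<in> closed_segment p q" "w' \<in> closed_segment r s"
  obtains u v where "0 \<le> u" "u \<le> 1" "0 \<le> v" "v \<le> 1"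
    "w = (1 - u) *\<^sub>R p + u *\<^sub>R q" "w' = (1 - v) *\<^sub>R r + v *\<^sub>R s"
  using assms unfolding in_segment by blast

lemma apartD:
  assumes "apart p q r s" "w \<in> closed_segment p q" "w' \<in> closed_segment r s"
  shows "shadow w \<noteq> shadow w'"
proof -
  obtain u v where uv: "0 \<le> u" "u \<le> 1" "0 \<le> v" "v \<le> 1"
    "w = (1 - u) *\<^sub>R p + u *\<^sub>R q" "w' = (1 - v) *\<^sub>R r + v *\<^sub>R s"
    using segments_cases[OF assms(2,3)] .
  obtain px py pz qx qy qz rx ry rz sx sy sz where
    "p = (px, py, pz)" "q = (qx, qy, qz)" "r = (rx, ry, rz)" "s = (sx, sy, sz)"
    by (metis prod_cases3)
  then show ?thesis
    using assms(1) uv convex_combination_less[OF _ _ _ _ uv(1-4)] convex_combination_less[OF _ _ _ _ uv(3,4,1,2)]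
    by (simp add: shadow_def) (metis less_irrefl)
qed

lemma lowerD:
  assumes "lower p q r s" "w \<in> closed_segment p q" "w' \<in> closed_segment r s"
  shows "height w < height w'"
proof -
  obtain u v where uv: "0 \<le> u" "u \<le> 1" "0 \<le> v" "v \<le> 1"
    "w = (1 - u) *\<^sub>R p + u *\<^sub>R q" "w' = (1 - v) *\<^sub>R r + v *\<^sub>R s"
    using segments_cases[OF assms(2,3)] .
  obtain px py pz qx qy qz rx ry rz sx sy sz where
    "p = (px, py, pz)" "q = (qx, qy, qz)" "r = (rx, ry, rz)" "s = (sx, sy, sz)"
    by (metis prod_cases3)
  then show ?thesis
    using assms(1) uv(5,6) convex_combination_less[OF _ _ _ _ uv(1-4)] by (simp add: height_def)
qed

lemma pinnedD:
  assumes "pinned p q r s" "w \<in> closed_segment p q" "w' \<in> closed_segment r s" "shadow w = shadow w'"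
  shows "w = p"
proof -
  obtain u v where uv: "0 \<le> u" "u \<le> 1" "0 \<le> v" "v \<le> 1"
    "w = (1 - u) *\<^sub>R p + u *\<^sub>R q" "w' = (1 - v) *\<^sub>R r + v *\<^sub>R s"
    using segments_cases[OF assms(2,3)] .
  obtain px py pz qx qy qz rx ry rz sx sy sz where
    eqs: "p = (px, py, pz)" "q = (qx, qy, qz)" "r = (rx, ry, rz)" "s = (sx, sy, sz)"
    by (metis prod_cases3)
  have "(1 - u) * px + u * qx = (1 - v) * rx + v * sx" "(1 - u) * py + u * qy = (1 - v) * ry + v * sy"
    using assms(4) unfolding uv(5,6) eqs by (simp_all add: shadow_def)
  then have "u = 0"
    using assms(1) convex_combination_pinned[OF _ uv(1-4)] unfolding eqs pinned.simps by metis
  then show ?thesis using uv(5) by simp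
qed

lemma segment_shadow_inj:
  assumes "shadow p \<noteq> shadow q" "w \<in> closed_segment p q" "w' \<in> closed_segment p q" "shadow w = shadow w'"
  shows "w = w'"
proof -
  obtain u v where uv:
    "w = (1 - u) *\<^sub>R p + u *\<^sub>R q" "w' = (1 - v) *\<^sub>R p + v *\<^sub>R q"
    using segments_cases[OF assms(2,3)] by metis
  have "(u - v) *\<^sub>R (shadow q - shadow p) = 0"
    using assms(4) unfolding uv by (simp add: algebra_simps)
  then show ?thesis using assms(1) uv by simp
qed

text \<open>The list \<open>E\<close> holds the endpoints of the moved arc, where it may meet the rest of the knot.\<close>

definition end_below :: "point3 list \<Rightarrow> point3 \<Rightarrow> point3 \<Rightarrow> point3 \<Rightarrow> bool" where
  "end_below E p r s \<longleftrightarrow> apart p p r s \<or> lower p p r s \<or> p \<in> set E \<and> (p = r \<or> p = s) \<and> shadow r \<noteq> shadow s"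

definition end_above :: "point3 list \<Rightarrow> point3 \<Rightarrow> point3 \<Rightarrow> point3 \<Rightarrow> bool" where
  "end_above E r p q \<longleftrightarrow> apart p q r r \<or> lower p q r r \<or> r \<in> set E \<and> (r = p \<or> r = q) \<or>
     pinned p q r r \<and> lower p p r r \<or> pinned q p r r \<and> lower q q r r"

definition edge_below :: "point3 list \<Rightarrow> point3 \<Rightarrow> point3 \<Rightarrow> point3 \<Rightarrow> point3 \<Rightarrow> bool" where
  "edge_below E p q r s \<longleftrightarrow> apart p q r s \<or> lower p q r s \<or>
     pinned p q r s \<and> end_below E p r s \<or> pinned q p r s \<and> end_below E q r s \<or>
     pinned r s p q \<and> end_above E r p q \<or> pinned s r p q \<and> end_above E s p q"

lemma end_belowD:
  assumes "end_below E p r s" "w' \<in> closed_segment r s" "shadow p = shadow w'"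
  shows "height p < height w' \<or> p = w' \<and> p \<in> set E"
  using assms(1) unfolding end_below_def
proof (elim disjE)
  assume *: "p \<in> set E \<and> (p = r \<or> p = s) \<and> shadow r \<noteq> shadow s"
  then have "p \<in> closed_segment r s" by auto
  then have "p = w'" using segment_shadow_inj[OF _ _ assms(2,3)] * by blast
  then show ?thesis using * by blast
qed (use apartD[of p p r s p w'] lowerD[of p p r s p w'] assms(2,3) in auto)

lemma end_aboveD:
  assumes "end_above E r p q" "w \<in> closed_segment p q" "shadow w = shadow r" "shadow p \<noteq> shadow q"
  shows "height w < height r \<or> w = r \<and> r \<in> set E"
  using assms(1) unfolding end_above_def
proof (elim disjE)
  assume *: "r \<in> set E \<and> (r = p \<or> r = q)"
  then have "r \<in> closed_segment p q" by auto
  then have "w = r" using segment_shadow_inj[OF assms(4,2) _ assms(3)] by blast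
  then show ?thesis using * by blast
next
  assume "pinned p q r r \<and> lower p p r r"
  then show ?thesis using pinnedD[of p q r r w r] lowerD[of p p r r p r] assms(2,3) by auto
next
  assume *: "pinned q p r r \<and> lower q q r r"
  have "w \<in> closed_segment q p" using assms(2) by (simp add: closed_segment_commute)
  then show ?thesis using * pinnedD[of q p r r w r] lowerD[of q q r r q r] assms(3) by auto
qed (use apartD[of p q r r w r] lowerD[of p q r r w r] assms(2,3) in auto)

lemma edge_belowD:
  assumes "edge_below E p q r s" "w \<in> closed_segment p q" "w' \<in> closed_segment r s" "shadow w = shadow w'"
    and "shadow p \<noteq> shadow q"
  shows "height w < height w' \<or> w = w' \<and> w \<in> set E"
proof -
  have w: "w \<in> closed_segment q p" and w': "w' \<in> closed_segment s r"
    using assms by (simp_all add: closed_segment_commute)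
  show ?thesis
    using assms(1) unfolding edge_below_def
  proof (elim disjE conjE)
    assume *: "pinned p q r s" "end_below E p r s"
    show ?thesis using pinnedD[OF *(1) assms(2-4)] end_belowD[OF *(2) assms(3)] assms(4) by simp
  next
    assume *: "pinned q p r s" "end_below E q r s"
    show ?thesis using pinnedD[OF *(1) w assms(3,4)] end_belowD[OF *(2) assms(3)] assms(4) by simp
  next
    assume *: "pinned r s p q" "end_above E r p q"
    show ?thesis using pinnedD[OF *(1) assms(3,2)] end_aboveD[OF *(2) assms(2) _ assms(5)] assms(4) by auto
  next
    assume *: "pinned s r p q" "end_above E s p q"
    show ?thesis using pinnedD[OF *(1) w' assms(2)] end_aboveD[OF *(2) assms(2) _ assms(5)] assms(4) by auto
  qed (use apartD[OF _ assms(2,3)] lowerD[OF _ assms(2,3)] assms(4) in auto)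
qed

fun edges :: "point3 list \<Rightarrow> (point3 \<times> point3) list" where
  "edges (p # q # ps) = (p, q) # edges (q # ps)"
| "edges ps = []"

lemma polyline_edges: "polyline ps = (\<Union>(p, q)\<in>set (edges ps). closed_segment p q)"
  by (induction ps rule: polyline.induct) auto

fun simple_check :: "point3 list \<Rightarrow> bool" where
  "simple_check (p # q # r # ps) \<longleftrightarrow> shadow p \<noteq> shadow q \<and> (pinned q p q r \<or> pinned q r p q) \<and>
     list_all (\<lambda>(s, t). apart p q s t) (edges (r # ps)) \<and> simple_check (q # r # ps)"
| "simple_check [p, q] \<longleftrightarrow> shadow p \<noteq> shadow q"
| "simple_check ps \<longleftrightarrow> True"

lemma simple_check_edges:
  "simple_check ps \<Longrightarrow> (p, q) \<in> set (edges ps) \<Longrightarrow> shadow p \<noteq> shadow q"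
  by (induction ps rule: simple_check.induct) auto

lemma plane_simple_if_check: "simple_check ps \<Longrightarrow> plane_simple ps"
proof (induction ps rule: simple_check.induct)
  case (1 p q r ps)
  have pq: "shadow p \<noteq> shadow q" and rest: "simple_check (q # r # ps)"
    and far: "\<And>s t. (s, t) \<in> set (edges (r # ps)) \<Longrightarrow> apart p q s t"
    using 1(2) by (auto simp: list_all_iff)
  have qr: "shadow q \<noteq> shadow r" using simple_check_edges[OF rest, of q r] by simp
  have "w = q \<and> w' = q" if w: "w \<in> closed_segment p q" and w': "w' \<in> polyline (q # r # ps)" and eq: "shadow w = shadow w'" for w w'
  proof (cases "w' \<in> closed_segment q r")
    case True
    have w2: "w \<in> closed_segment q p" using w by (simp add: closed_segment_commute)
    from 1(2) consider "pinned q p q r" | "pinned q r p q" by auto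
    then show ?thesis
    proof cases
      case 1
      then have "w = q" using pinnedD[OF 1 w2 True eq] by simp
      then show ?thesis using segment_shadow_inj[OF qr True, of q] eq by auto
    next
      case 2
      then have "w' = q" using pinnedD[OF 2 True w] eq by simp
      then show ?thesis using segment_shadow_inj[OF pq w, of q] eq by auto
    qed
  next
    case False
    then obtain s t where st: "(s, t) \<in> set (edges (r # ps))" "w' \<in> closed_segment s t"
      using w' polyline_edges[of "r # ps"] by auto
    then show ?thesis using apartD[OF far[OF st(1)] w st(2)] eq by simp
  qed
  then show ?case using 1(1)[OF rest] pq by simp
qed auto

section \<open>Replacing an arc inside a diagram\<close>

lemma polyline_append: "polyline (xs @ p # ys) = polyline (xs @ [p]) \<union> polyline (p # ys)"
proof (induction xs rule: polyline.induct)
  case (1 q r ps)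
  then show ?case by (simp add: Un_assoc)
next
  case ("2_2" q)
  then show ?case by (cases ys) auto
qed simp

lemma polyline_replace:
  assumes "length A \<ge> 2"
  shows "polyline (U @ A @ W) = polyline A \<union> (polyline (U @ [hd A]) \<union> polyline (last A # W))"
proof -
  obtain p q ps where A: "A = p # q # ps" using assms by (metis Suc_le_length_iff numeral_2_eq_2)
  have "polyline (U @ A @ W) = polyline (U @ [p]) \<union> polyline (A @ W)"
    using polyline_append[of U p "q # ps @ W"] unfolding A by simp
  also have "polyline (A @ W) = polyline A \<union> polyline (last A # W)"
  proof -
    have A': "butlast A @ [last A] = A" unfolding A by (rule append_butlast_last_id) simp
    then have AW: "A @ W = butlast A @ last A # W" by (metis append.assoc append_Cons append_Nil)
    show ?thesis unfolding AW polyline_append[of "butlast A" "last A" W] A' ..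
  qed
  finally show ?thesis unfolding A by (simp add: Un_ac)
qed

text \<open>
  The part of a diagram that the first \<open>N\<close> moves have produced, together with the pieces of the passive strand
  next to it, leaves its box only at the points \<open>Zs\<close> where the variable part of the diagram is attached.
\<close>

definition core :: "real \<Rightarrow> point3 list \<Rightarrow> point3 set \<Rightarrow> bool" where
  "core N Zs C \<longleftrightarrow> segment_union C \<and>
     (\<forall>w\<in>C. \<bar>fst w\<bar> < N + 1 \<and> 1/2 - N < fst (snd w) \<and> fst (snd w) < N + 1/2 \<or> w \<in> set Zs)"

text \<open>The box is open, so closed half-planes along its sides are enough. A moved arc may
  therefore run along the boundary, where the prefix is attached.\<close>

fun outside :: "real \<Rightarrow> point3 \<Rightarrow> point3 \<Rightarrow> bool" where
  "outside N (px, py, pz) (qx, qy, qz) \<longleftrightarrow>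
     N + 1 \<le> px \<and> N + 1 \<le> qx \<or> px \<le> - N - 1 \<and> qx \<le> - N - 1 \<or>
     N + 1/2 \<le> py \<and> N + 1/2 \<le> qy \<or> py \<le> 1/2 - N \<and> qy \<le> 1/2 - N"

definition core_check :: "real \<Rightarrow> point3 list \<Rightarrow> point3 list \<Rightarrow> bool" where
  "core_check N Zs A \<longleftrightarrow>
     list_all (\<lambda>(p, q). outside N p q \<and> list_all (\<lambda>Z. end_above [hd A, last A] Z p q) Zs) (edges A)"

definition arc_check :: "point3 list list \<Rightarrow> point3 list \<Rightarrow> bool" where
  "arc_check Rs A \<longleftrightarrow> length A \<ge> 2 \<and> simple_check A \<and>
     list_all (\<lambda>(p, q). list_all (\<lambda>R. list_all (\<lambda>(r, s). edge_below [hd A, last A] p q r s) (edges R)) Rs) (edges A)"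

lemma outside_segment:
  assumes "outside N p q" "w \<in> closed_segment p q"
  shows "\<not> (\<bar>fst w\<bar> < N + 1 \<and> 1/2 - N < fst (snd w) \<and> fst (snd w) < N + 1/2)"
proof -
  obtain px py pz qx qy qz where eqs: "p = (px, py, pz)" "q = (qx, qy, qz)" by (metis prod_cases3)
  obtain u where u: "0 \<le> u" "u \<le> 1" "w = (1 - u) *\<^sub>R p + u *\<^sub>R q"
    using assms(2) unfolding in_segment by blast
  have le: "(1 - u) * a + u * b \<le> c" if "a \<le> c" "b \<le> c" for a b c
    using convex_bound_le[OF that, of "1 - u" u] u by simp
  have ge: "c \<le> (1 - u) * a + u * b" if "c \<le> a" "c \<le> b" for a b c
    using le[of "- a" "- c" "- b"] that by simp
  have w: "fst w = (1 - u) * px + u * qx" "fst (snd w) = (1 - u) * py + u * qy"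
    unfolding u(3) eqs by simp_all
  from assms(1) consider "N + 1 \<le> px \<and> N + 1 \<le> qx" | "px \<le> - N - 1 \<and> qx \<le> - N - 1" |
     "N + 1/2 \<le> py \<and> N + 1/2 \<le> qy" | "py \<le> 1/2 - N \<and> qy \<le> 1/2 - N"
    unfolding eqs by auto
  then show ?thesis
  proof cases
    case 1
    then show ?thesis using ge[of "N + 1" px qx] unfolding w by linarith
  next
    case 2
    then show ?thesis using le[of px "- N - 1" qx] unfolding w by linarith
  next
    case 3
    then show ?thesis using ge[of "N + 1/2" py qy] unfolding w by linarith
  next
    case 4
    then show ?thesis using le[of py "1/2 - N" qy] unfolding w by linarith
  qed
qed

lemma lies_under_core:
  assumes "core N Zs C" "core_check N Zs A" "simple_check A"
  shows "lies_under {hd A, last A} (polyline A) C"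
  unfolding lies_under_def
proof (intro ballI impI)
  fix w w' assume w: "w \<in> polyline A" and w': "w' \<in> C" and eq: "shadow w = shadow w'"
  obtain p q where pq: "(p, q) \<in> set (edges A)" "w \<in> closed_segment p q"
    using w unfolding polyline_edges by blast
  have out: "outside N p q" and ends: "\<And>Z. Z \<in> set Zs \<Longrightarrow> end_above [hd A, last A] Z p q"
    using assms(2) pq(1) unfolding core_check_def list_all_iff by auto
  have "fst w = fst w'" "fst (snd w) = fst (snd w')" using eq by (simp_all add: shadow_def)
  then have "w' \<in> set Zs"
    using outside_segment[OF out pq(2)] assms(1) w' unfolding core_def by auto
  then show "height w < height w' \<or> w = w' \<and> w \<in> {hd A, last A}"
    using end_aboveD[OF ends pq(2) eq simple_check_edges[OF assms(3) pq(1)]] by auto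
qed

lemma lies_under_polylines:
  assumes "arc_check Rs A"
  shows "lies_under {hd A, last A} (polyline A) (\<Union>R\<in>set Rs. polyline R)"
  unfolding lies_under_def
proof (intro ballI impI)
  fix w w' assume w: "w \<in> polyline A" and w': "w' \<in> (\<Union>R\<in>set Rs. polyline R)" and eq: "shadow w = shadow w'"
  obtain p q where pq: "(p, q) \<in> set (edges A)" "w \<in> closed_segment p q"
    using w unfolding polyline_edges by blast
  obtain R r s where rs: "R \<in> set Rs" "(r, s) \<in> set (edges R)" "w' \<in> closed_segment r s"
    using w' unfolding polyline_edges by blast
  have eb: "edge_below [hd A, last A] p q r s"
    using assms pq(1) rs(1,2) unfolding arc_check_def list_all_iff by fastforce
  then show "height w < height w' \<or> w = w' \<and> w \<in> {hd A, last A}"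
    using edge_belowD[OF eb pq(2) rs(3) eq simple_check_edges[OF _ pq(1)]] assms unfolding arc_check_def by simp
qed

lemma lies_under_Un: "lies_under E A R \<Longrightarrow> lies_under E A S \<Longrightarrow> lies_under E A (R \<union> S)"
  unfolding lies_under_def by blast

lemma segment_union_polylines: "segment_union (\<Union>R\<in>set Rs. polyline R)"
  by (induction Rs) auto

text \<open>For diagrams without a boxed prefix: \<open>T\<close> and the strand containing the
  moved arc make up the whole knot.\<close>

lemma move_under:
  assumes ends: "hd A = hd B" "last A = last B"
    and A: "arc_check [T, U @ [hd A], last A # W] A"
    and B: "arc_check [T, U @ [hd A], last A # W] B"
  shows "equivalent_knots (polyline T \<union> polyline (U @ A @ W)) (polyline T \<union> polyline (U @ B @ W))"
proof -
  define R where "R = (\<Union>R\<in>set [T, U @ [hd A], last A # W]. polyline R)"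
  have len: "length A \<ge> 2" "length B \<ge> 2" and simple: "simple_check A" "simple_check B"
    using A B unfolding arc_check_def by auto
  have "equivalent_knots (polyline A \<union> R) (polyline B \<union> R)"
  proof (rule arc_move_under[OF _ len(1) _ _ len(2) _ _ ends])
    show "segment_union R" unfolding R_def by (rule segment_union_polylines)
    show "lies_under {hd A, last A} (polyline A) R"
      unfolding R_def by (rule lies_under_polylines[OF A])
    show "lies_under {hd A, last A} (polyline B) R"
      unfolding R_def ends by (rule lies_under_polylines) (use B in \<open>simp add: ends\<close>)
  qed (intro plane_simple_if_check simple)+
  then show ?thesis
    unfolding R_def polyline_replace[OF len(1)] polyline_replace[OF len(2)]
    by (simp add: ends Un_ac)
qed

lemma core_move_under:
  assumes C: "core N Zs C"
    and ends: "hd A = hd B" "last A = last B"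
    and A: "arc_check [T, U @ [hd A], last A # W] A" "core_check N Zs A"
    and B: "arc_check [T, U @ [hd A], last A # W] B" "core_check N Zs B"
  shows "equivalent_knots (C \<union> polyline T \<union> polyline (U @ A @ W)) (C \<union> polyline T \<union> polyline (U @ B @ W))"
proof -
  define R where "R = C \<union> (\<Union>R\<in>set [T, U @ [hd A], last A # W]. polyline R)"
  have len: "length A \<ge> 2" "length B \<ge> 2" and simple: "simple_check A" "simple_check B"
    using A B unfolding arc_check_def by auto
  have "equivalent_knots (polyline A \<union> R) (polyline B \<union> R)"
  proof (rule arc_move_under[OF _ len(1) _ _ len(2) _ _ ends])
    show "segment_union R" unfolding R_def using C segment_union_polylines
      unfolding core_def by (intro segment_union_Un) auto
    show "lies_under {hd A, last A} (polyline A) R"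
      unfolding R_def by (intro lies_under_Un lies_under_polylines[OF A(1)] lies_under_core[OF C A(2) simple(1)])
    show "lies_under {hd A, last A} (polyline B) R"
      unfolding R_def ends
      by (intro lies_under_Un lies_under_polylines lies_under_core[OF C B(2) simple(2)]) (use B in \<open>simp add: ends\<close>)
  qed (intro plane_simple_if_check simple)+
  then show ?thesis
    unfolding R_def polyline_replace[OF len(1)] polyline_replace[OF len(2)]
    by (simp add: ends Un_ac)
qed

lemma core_mirror:
  assumes "core N Zs C"
  shows "core N (map mirror_z Zs) (mirror_z ` C)" "core N (map mirror_x Zs) (mirror_x ` C)"
proof -
  have coords: "fst (mirror_z w) = fst w" "fst (snd (mirror_z w)) = fst (snd w)"
    "\<bar>fst (mirror_x w)\<bar> = \<bar>fst w\<bar>" "fst (snd (mirror_x w)) = fst (snd w)" for w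
    by (cases w; simp)+
  show "core N (map mirror_z Zs) (mirror_z ` C)" "core N (map mirror_x Zs) (mirror_x ` C)"
    using assms segment_union_mirror unfolding core_def ball_simps(9) coords set_map by blast+
qed

lemma arc_check_nonempty: "arc_check Rs A \<Longrightarrow> A \<noteq> []"
  unfolding arc_check_def by auto

lemma move_over:
  fixes A B :: "point3 list"
  assumes ends: "hd A = hd B" "last A = last B"
    and A: "arc_check (map (map mirror_z) [T, U @ [hd A], last A # W]) (map mirror_z A)"
    and B: "arc_check (map (map mirror_z) [T, U @ [hd A], last A # W]) (map mirror_z B)"
  shows "equivalent_knots (polyline T \<union> polyline (U @ A @ W)) (polyline T \<union> polyline (U @ B @ W))"
proof -
  have ne: "A \<noteq> []" "B \<noteq> []" using A B arc_check_nonempty by auto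
  have "equivalent_knots (polyline (map mirror_z T) \<union> polyline (map mirror_z U @ map mirror_z A @ map mirror_z W))
      (polyline (map mirror_z T) \<union> polyline (map mirror_z U @ map mirror_z B @ map mirror_z W))"
    by (rule move_under) (use A B ends ne in \<open>simp_all add: hd_map last_map\<close>)
  then show ?thesis
    using equivalent_knots_mirror(2)[of "polyline T \<union> polyline (U @ A @ W)" "polyline T \<union> polyline (U @ B @ W)"]
    by (simp add: image_Un mirror_polyline)
qed

lemma core_move_over:
  fixes A B :: "point3 list"
  assumes C: "core N Zs C"
    and ends: "hd A = hd B" "last A = last B"
    and A: "arc_check (map (map mirror_z) [T, U @ [hd A], last A # W]) (map mirror_z A)" "core_check N (map mirror_z Zs) (map mirror_z A)"
    and B: "arc_check (map (map mirror_z) [T, U @ [hd A], last A # W]) (map mirror_z B)" "core_check N (map mirror_z Zs) (map mirror_z B)"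
  shows "equivalent_knots (C \<union> polyline T \<union> polyline (U @ A @ W)) (C \<union> polyline T \<union> polyline (U @ B @ W))"
proof -
  have ne: "A \<noteq> []" "B \<noteq> []" using A B arc_check_nonempty by auto
  have "equivalent_knots (mirror_z ` C \<union> polyline (map mirror_z T) \<union> polyline (map mirror_z U @ map mirror_z A @ map mirror_z W))
      (mirror_z ` C \<union> polyline (map mirror_z T) \<union> polyline (map mirror_z U @ map mirror_z B @ map mirror_z W))"
    by (rule core_move_under[OF core_mirror(1)[OF C]]) (use A B ends ne in \<open>simp_all add: hd_map last_map\<close>)
  then show ?thesis
    using equivalent_knots_mirror(2)[of "C \<union> polyline T \<union> polyline (U @ A @ W)" "C \<union> polyline T \<union> polyline (U @ B @ W)"]
    by (simp add: image_Un mirror_polyline)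
qed

section \<open>Moves in the complement of a box\<close>

text \<open>As conditional rewrite rules the clauses of the check are tried one after the other and abandoned at
  the first failing comparison, which is much faster than unfolding them.\<close>

lemma apart_intros:
  "px < rx \<Longrightarrow> px < sx \<Longrightarrow> qx < rx \<Longrightarrow> qx < sx \<Longrightarrow> apart (px, py, pz) (qx, qy, qz) (rx, ry, rz) (sx, sy, sz)"
  "rx < px \<Longrightarrow> rx < qx \<Longrightarrow> sx < px \<Longrightarrow> sx < qx \<Longrightarrow> apart (px, py, pz) (qx, qy, qz) (rx, ry, rz) (sx, sy, sz)"
  "py < ry \<Longrightarrow> py < sy \<Longrightarrow> qy < ry \<Longrightarrow> qy < sy \<Longrightarrow> apart (px, py, pz) (qx, qy, qz) (rx, ry, rz) (sx, sy, sz)"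
  "ry < py \<Longrightarrow> ry < qy \<Longrightarrow> sy < py \<Longrightarrow> sy < qy \<Longrightarrow> apart (px, py, pz) (qx, qy, qz) (rx, ry, rz) (sx, sy, sz)"
  by simp_all

lemma lower_intro:
  "pz < rz \<Longrightarrow> pz < sz \<Longrightarrow> qz < rz \<Longrightarrow> qz < sz \<Longrightarrow> lower (px, py, pz) (qx, qy, qz) (rx, ry, rz) (sx, sy, sz)"
  by simp

lemma pinned_intros:
  "px < qx \<Longrightarrow> rx \<le> px \<Longrightarrow> sx \<le> px \<Longrightarrow> pinned (px, py, pz) (qx, qy, qz) (rx, ry, rz) (sx, sy, sz)"
  "qx < px \<Longrightarrow> px \<le> rx \<Longrightarrow> px \<le> sx \<Longrightarrow> pinned (px, py, pz) (qx, qy, qz) (rx, ry, rz) (sx, sy, sz)"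
  "py < qy \<Longrightarrow> ry \<le> py \<Longrightarrow> sy \<le> py \<Longrightarrow> pinned (px, py, pz) (qx, qy, qz) (rx, ry, rz) (sx, sy, sz)"
  "qy < py \<Longrightarrow> py \<le> ry \<Longrightarrow> py \<le> sy \<Longrightarrow> pinned (px, py, pz) (qx, qy, qz) (rx, ry, rz) (sx, sy, sz)"
  by simp_all

lemma outside_intros:
  "N + 1 \<le> px \<Longrightarrow> N + 1 \<le> qx \<Longrightarrow> outside N (px, py, pz) (qx, qy, qz)"
  "px \<le> - N - 1 \<Longrightarrow> qx \<le> - N - 1 \<Longrightarrow> outside N (px, py, pz) (qx, qy, qz)"
  "N + 1/2 \<le> py \<Longrightarrow> N + 1/2 \<le> qy \<Longrightarrow> outside N (px, py, pz) (qx, qy, qz)"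
  "py \<le> 1/2 - N \<Longrightarrow> qy \<le> 1/2 - N \<Longrightarrow> outside N (px, py, pz) (qx, qy, qz)"
  by simp_all

lemma shadow_neq_intros:
  "px < qx \<Longrightarrow> shadow (px, py, pz) \<noteq> shadow (qx, qy, qz)"
  "qx < px \<Longrightarrow> shadow (px, py, pz) \<noteq> shadow (qx, qy, qz)"
  "py < qy \<Longrightarrow> shadow (px, py, pz) \<noteq> shadow (qx, qy, qz)"
  "qy < py \<Longrightarrow> shadow (px, py, pz) \<noteq> shadow (qx, qy, qz)"
  by (auto simp: shadow_def)

lemma end_below_intros:
  "apart p p r s \<Longrightarrow> end_below E p r s"
  "lower p p r s \<Longrightarrow> end_below E p r s"
  "p = r \<Longrightarrow> p \<in> set E \<Longrightarrow> shadow r \<noteq> shadow s \<Longrightarrow> end_below E p r s"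
  "p = s \<Longrightarrow> p \<in> set E \<Longrightarrow> shadow r \<noteq> shadow s \<Longrightarrow> end_below E p r s"
  by (auto simp: end_below_def)

lemma end_above_intros:
  "apart p q r r \<Longrightarrow> end_above E r p q"
  "lower p q r r \<Longrightarrow> end_above E r p q"
  "r = p \<Longrightarrow> r \<in> set E \<Longrightarrow> end_above E r p q"
  "r = q \<Longrightarrow> r \<in> set E \<Longrightarrow> end_above E r p q"
  "lower p p r r \<Longrightarrow> pinned p q r r \<Longrightarrow> end_above E r p q"
  "lower q q r r \<Longrightarrow> pinned q p r r \<Longrightarrow> end_above E r p q"
  by (auto simp: end_above_def)

lemma edge_below_intros:
  "pinned s r p q \<Longrightarrow> end_above E s p q \<Longrightarrow> edge_below E p q r s"
  "pinned r s p q \<Longrightarrow> end_above E r p q \<Longrightarrow> edge_below E p q r s"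
  "pinned q p r s \<Longrightarrow> end_below E q r s \<Longrightarrow> edge_below E p q r s"
  "pinned p q r s \<Longrightarrow> end_below E p r s \<Longrightarrow> edge_below E p q r s"
  "lower p q r s \<Longrightarrow> edge_below E p q r s"
  "apart p q r s \<Longrightarrow> edge_below E p q r s"
  by (auto simp: edge_below_def)

declare apart.simps [simp del] lower.simps [simp del] pinned.simps [simp del] outside.simps [simp del]

lemmas check_simps = arc_check_def core_check_def apart_intros lower_intro pinned_intros outside_intros
  shadow_neq_intros end_below_intros end_above_intros edge_below_intros

section \<open>Subdividing edges, and the arc moves in directly applicable form\<close>

lemma polyline_rev: "polyline (rev ps) = polyline ps"
proof (induction ps rule: polyline.induct)
  case (1 p q ps)
  have "polyline (rev (p # q # ps)) = polyline (rev ps @ q # [p])" by simp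
  also have "\<dots> = polyline (rev (q # ps)) \<union> polyline [q, p]"
    unfolding polyline_append[of "rev ps" q "[p]"] by simp
  also have "\<dots> = polyline (p # q # ps)" using 1 by (simp add: closed_segment_commute Un_commute)
  finally show ?case .
qed simp_all

lemma polyline_insert:
  assumes "x \<in> closed_segment p q"
  shows "polyline (U @ p # x # q # W) = polyline (U @ p # q # W)"
proof -
  have "closed_segment p q = closed_segment p x \<union> closed_segment x q"
    using Un_closed_segment[OF assms] by simp
  then show ?thesis
    unfolding polyline_append[of U p "x # q # W"] polyline_append[of U p "q # W"] by (simp add: Un_assoc)
qed

lemma in_vertical_segment:
  fixes x y y1 y2 z :: real
  assumes "y1 \<le> y \<and> y \<le> y2 \<or> y2 \<le> y \<and> y \<le> y1"
  shows "(x, y, z) \<in> closed_segment (x, y1, z) (x, y2, z)"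
proof (cases "y1 = y2")
  case False
  define u where "u = (y - y1) / (y2 - y1)"
  have "0 \<le> u" "u \<le> 1" using assms False unfolding u_def by (auto simp: divide_simps)
  moreover have "u * (y2 - y1) = y - y1" using False unfolding u_def by simp
  then have "(1 - u) * y1 + u * y2 = y" by (simp add: algebra_simps)
  ultimately show ?thesis
    unfolding in_segment by (intro exI[of _ u]) (simp add: algebra_simps)
qed (use assms in auto)

text \<open>With the decompositions as premises, the rule applies to whole vertex lists and the
  splitting is checked together with the coordinates.\<close>

lemma active_move_under:
  assumes "core N Zs C" and eq: "M = U @ A @ W" "M' = U @ B @ W"
    and "hd A = hd B" "last A = last B"
    and "arc_check [T, U @ [hd A], last A # W] A" "core_check N Zs A"
    and "arc_check [T, U @ [hd A], last A # W] B" "core_check N Zs B"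
  shows "equivalent_knots (C \<union> polyline T \<union> polyline M) (C \<union> polyline T \<union> polyline M')"
  unfolding eq by (rule core_move_under[OF assms(1,4-)])

lemma active_move_over:
  assumes "core N Zs C" and eq: "M = U @ A @ W" "M' = U @ B @ W"
    and "hd A = hd B" "last A = last B"
    and "arc_check (map (map mirror_z) [T, U @ [hd A], last A # W]) (map mirror_z A)" "core_check N (map mirror_z Zs) (map mirror_z A)"
    and "arc_check (map (map mirror_z) [T, U @ [hd A], last A # W]) (map mirror_z B)" "core_check N (map mirror_z Zs) (map mirror_z B)"
  shows "equivalent_knots (C \<union> polyline T \<union> polyline M) (C \<union> polyline T \<union> polyline M')"
  unfolding eq by (rule core_move_over[OF assms(1,4-)])

text \<open>Here the moved arc belongs to the neck loop, while the active strand \<open>M\<close> is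
  fixed.\<close>

lemma loop_move_under:
  assumes "core N Zs C" and eq: "T = U @ A @ W" "T' = U @ B @ W"
    and "hd A = hd B" "last A = last B"
    and "arc_check [M, U @ [hd A], last A # W] A" "core_check N Zs A"
    and "arc_check [M, U @ [hd A], last A # W] B" "core_check N Zs B"
  shows "equivalent_knots (C \<union> polyline T \<union> polyline M) (C \<union> polyline T' \<union> polyline M)"
  using core_move_under[OF assms(1,4-)] unfolding eq by (simp only: Un_assoc Un_commute[of "polyline M"])

section \<open>The reductions in coordinates\<close>

text \<open>A Reidemeister I move. N counts the moves before the kink; V is where the active strand
  leaves the box. D, E and F cut the straight strand and the two sides of the neck loop at
  half-integers, between the crossings of the first N moves and the later ones.\<close>

lemma kink_left:
  fixes N v :: real
  defines "V \<equiv> (- N - 1, v, 0)" and "D \<equiv> (0, 1/2 - N, 0)" and "E \<equiv> (- 1, N + 1/2, 0)" and "F \<equiv> (1, N + 1/2, 0)"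
  assumes N: "1 \<le> N" and v: "1 - N \<le> v" "v \<le> N" and C: "core N [V, D, E, F] C"
  shows "equivalent_knots
    (C \<union> polyline [E, (- 1, N + 2, 0), (1, N + 2, 0), F] \<union>
     polyline [V, (- N - 1, - N, 0), (0, - N, - 1), (N + 2, - N, 0), (N + 2, - N - 1, 0), (0, - N - 1, 0), D])
    (C \<union> polyline [E, (- 1, N + 1, 0), (1, N + 1, 0), F] \<union>
     polyline [V, (- N - 1, - N, 0), (0, - N, 0), D])"
    (is "equivalent_knots (C \<union> polyline ?T \<union> polyline ?M) (C \<union> polyline ?T' \<union> polyline ?M')")
proof -
  let ?A = "[(- N - 1, - N, 0), (0, - N, - 1), (N + 2, - N, 0), (N + 2, - N - 1, 0)]"
  \<comment> \<open>The detour runs at height - N - 2, below the end (0, - N - 1, 0) of the straight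
    strand, and so removes the crossing.\<close>
  let ?B = "[(- N - 1, - N, 0), (- N - 1, - N - 2, 0), (N + 2, - N - 2, 0), (N + 2, - N - 1, 0)]"
  note defs = V_def D_def E_def F_def
  have "equivalent_knots (C \<union> polyline ?T \<union> polyline ?M)
      (C \<union> polyline ?T \<union> polyline ([V] @ ?B @ [(0, - N - 1, 0), D]))"
    by (rule active_move_under[OF C, where U="[V]" and A="?A" and B="?B" and W="[(0, - N - 1, 0), D]"])
      (use N v in \<open>simp_all add: check_simps defs\<close>)
  also have "equivalent_knots \<dots> (C \<union> polyline ?T \<union> polyline ?M')"
    by (rule active_move_under[OF C, where U="[V]" and A="?B @ [(0, - N - 1, 0), D]" and B="tl ?M'" and W="[]"])
      (use N v in \<open>simp_all add: check_simps defs\<close>)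
  \<comment> \<open>One crossing fewer means that the neck loop is drawn one unit lower.\<close>
  also have "equivalent_knots \<dots> (C \<union> polyline ?T' \<union> polyline ?M')"
    by (rule loop_move_under[OF C, where U="[]" and A="?T" and B="?T'" and W="[]"])
      (use N v in \<open>simp_all add: check_simps defs\<close>)
  finally show ?thesis .
qed

text \<open>The case of \<open>R\<^sub>o L\<^sub>i C\<^sub>o T\<close> after a move to the left. Of
  the crossings made after V, a \<open>C\<^sub>o\<close> and the crossing t1 survive, because one of
  them is under and the other is over.\<close>

lemma tuck_after_straight_left:
  fixes N v :: real
  defines "V \<equiv> (- N - 1, v, 0)" and "D \<equiv> (0, 1/2 - N, 0)" and "E \<equiv> (- 1, N + 1/2, 0)" and "F \<equiv> (1, N + 1/2, 0)"
  assumes N: "1 \<le> N" and v: "1 - N \<le> v" "v \<le> N" and C: "core N [V, D, E, F] C"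
  shows "equivalent_knots
    (C \<union> polyline [E, (- 1, N + 5, 0), (1, N + 5, 0), F] \<union>
     polyline [V, (- N - 1, - N, 0), (0, - N, - 1), (N + 2, - N, 0), (N + 2, - N - 1, 0), (0, - N - 1, 1),
       (- N - 3, - N - 1, 0), (- N - 3, N + 3, 0), (- 1, N + 3, - 1), (0, N + 3, 0), (0, N + 4, 0),
       (1, N + 4, 1), (N + 5, N + 4, 0), (N + 5, - N - 1/3, 0), (N + 2, - N - 1/3, 1),
       (N + 3/2, - N - 1/3, 0), (N + 3/2, - N - 2/3, 0), (N + 2, - N - 2/3, - 1), (N + 5, - N - 2/3, 0),
       (N + 5, - N - 4, 0), (0, - N - 4, 0), D])
    (C \<union> polyline [E, (- 1, N + 3, 0), (1, N + 3, 0), F] \<union>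
     polyline [V, (- N - 1, N + 1, 0), (- 1, N + 1, - 1), (0, N + 1, 0), (0, N + 2, 0), (1, N + 2, 1),
       (N + 3, N + 2, 0), (N + 3, - N - 2, 0), (0, - N - 2, 0), D])"
    (is "equivalent_knots (C \<union> polyline ?T \<union> polyline ?M) (C \<union> polyline ?T' \<union> polyline ?M')")
proof -
  \<comment> \<open>The straight strand is above the active strand at height - N, where
    \<open>R\<^sub>o\<close> crosses, and below it at - N - 1, where \<open>L\<^sub>i\<close>
    crosses. Cutting between the two keeps the part from b up to X an under-arc; the height is that
    of t3, so the shortened hook is horizontal.\<close>
  define X :: point3 where "X = (0, - N - 2/3, 0)"
  note defs = V_def D_def E_def F_def X_def
  let ?hook = "[(N + 3/2, - N - 2/3, 0), (N + 2, - N - 2/3, - 1), (N + 5, - N - 2/3, 0), (N + 5, - N - 4, 0),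
      (0, - N - 4, 0), X]"
  let ?loop = "[V, (- N - 1, - N, 0), (0, - N, - 1), (N + 2, - N, 0), (N + 2, - N - 1, 0), (0, - N - 1, 1),
      (- N - 3, - N - 1, 0), (- N - 3, N + 3, 0), (- 1, N + 3, - 1), (0, N + 3, 0)]"
  let ?tail = "[(0, N + 4, 0), (1, N + 4, 1), (N + 5, N + 4, 0), (N + 5, - N - 1/3, 0), (N + 2, - N - 1/3, 1),
      (N + 3/2, - N - 1/3, 0)]"
  let ?hook' = "[(N + 3/2, - N - 2/3, 0), X]"
  let ?start = "[V, (- N - 1, N + 1, 0), (- 1, N + 1, - 1)]"
  let ?end = "[(0, N + 1, 0), (0, N + 2, 0), (1, N + 2, 1), (N + 3, N + 2, 0), (N + 3, - N - 2, 0),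
      (0, - N - 2, 0), X]"
  \<comment> \<open>In the final diagram the neck loop is crossed at N + 1 on the left and N + 2 on
    the right, once under and once over. Cut above these heights, its top has no crossings and can
    be lowered.\<close>
  let ?P = "(- 1, N + 5/2, 0)" and ?Q = "(1, N + 5/2, 0)"
  have "X \<in> closed_segment (0, - N - 4, 0) D" "X \<in> closed_segment (0, - N - 2, 0) D"
    "?P \<in> closed_segment E (- 1, N + 5, 0)" "?P \<in> closed_segment E (- 1, N + 3, 0)"
    "?Q \<in> closed_segment (1, N + 5, 0) F" "?Q \<in> closed_segment (1, N + 3, 0) F"
    using N unfolding defs by (intro in_vertical_segment; simp)+
  note inserts = this[THEN polyline_insert]
  have M: "polyline ?M = polyline (?loop @ ?tail @ ?hook @ [D])"
    using inserts(1)[of "butlast (butlast ?M)" "[]"]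
    by (simp only: append.simps butlast.simps list.simps if_False if_True simp_thms)
  have M': "polyline ?M' = polyline (?start @ ?end @ [D])"
    using inserts(2)[of "butlast (butlast ?M')" "[]"]
    by (simp only: append.simps butlast.simps list.simps if_False if_True simp_thms)
  have T: "polyline ?T = polyline ([E] @ [?P, (- 1, N + 5, 0), (1, N + 5, 0), ?Q] @ [F])"
    using inserts(3)[of "[]" "[(1, N + 5, 0), F]"] inserts(5)[of "[E, ?P, (- 1, N + 5, 0)]" "[]"]
    by (simp only: append.simps)
  have T': "polyline ?T' = polyline ([E] @ [?P, (- 1, N + 3, 0), (1, N + 3, 0), ?Q] @ [F])"
    using inserts(4)[of "[]" "[(1, N + 3, 0), F]"] inserts(6)[of "[E, ?P, (- 1, N + 3, 0)]" "[]"]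
    by (simp only: append.simps)
  have "equivalent_knots (C \<union> polyline ?T \<union> polyline ?M)
      (C \<union> polyline ?T \<union> polyline (?loop @ ?tail @ ?hook' @ [D]))"
    unfolding M
    by (rule active_move_under[OF C, where U="?loop @ ?tail" and A="?hook" and B="?hook'" and W="[D]"])
      (use N v in \<open>simp_all add: check_simps defs\<close>)
  \<comment> \<open>The straight strand now turns off at X, so the \<open>L\<^sub>i\<close> crossing
    at - N - 1 has disappeared. The crossings left on this arc, those of \<open>R\<^sub>o\<close>,
    t2 and \<open>C\<^sub>o\<close>, all have the arc below.\<close>
  also have "equivalent_knots \<dots> (C \<union> polyline ?T \<union> polyline (?start @ [(0, N + 1, 0), (0, N + 3, 0)] @ ?tail @ ?hook' @ [D]))"
    by (rule active_move_under[OF C, where U="[]" and A="?loop" and B="?start @ [(0, N + 1, 0), (0, N + 3, 0)]" and W="?tail @ ?hook' @ [D]"])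
      (use N v in \<open>simp_all add: check_simps defs\<close>)
  \<comment> \<open>With \<ell> gone, t1 is the only crossing after \<open>C\<^sub>o\<close>, and it
    is over.\<close>
  also have "equivalent_knots \<dots> (C \<union> polyline ?T \<union> polyline ?M')"
    unfolding M'
    by (rule active_move_over[OF C, where U="?start" and A="[(0, N + 1, 0), (0, N + 3, 0)] @ ?tail @ ?hook'" and B="?end" and W="[D]"])
      (use N v in \<open>simp_all add: check_simps defs\<close>)
  also have "equivalent_knots \<dots> (C \<union> polyline ?T' \<union> polyline ?M')"
    unfolding T T'
    by (rule loop_move_under[OF C, where U="[E]" and A="[?P, (- 1, N + 5, 0), (1, N + 5, 0), ?Q]"
          and B="[?P, (- 1, N + 3, 0), (1, N + 3, 0), ?Q]" and W="[F]"])
      (use N v in \<open>simp_all add: check_simps defs\<close>)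
  finally show ?thesis .
qed

lemma closed_move_under:
  assumes eq: "M = U @ A @ W" "M' = U @ B @ W" and "hd A = hd B" "last A = last B"
    and "arc_check [T, U @ [hd A], last A # W] A" "arc_check [T, U @ [hd A], last A # W] B"
  shows "equivalent_knots (polyline T \<union> polyline M) (polyline T \<union> polyline M')"
  unfolding eq by (rule move_under[OF assms(3-)])

lemma closed_move_over:
  assumes eq: "M = U @ A @ W" "M' = U @ B @ W" and "hd A = hd B" "last A = last B"
    and "arc_check (map (map mirror_z) [T, U @ [hd A], last A # W]) (map mirror_z A)"
    and "arc_check (map (map mirror_z) [T, U @ [hd A], last A # W]) (map mirror_z B)"
  shows "equivalent_knots (polyline T \<union> polyline M) (polyline T \<union> polyline M')"
  unfolding eq by (rule move_over[OF assms(3-)])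

text \<open>Again a Reidemeister I move, but at the vertex (0, 0, 0) of the passive strand, with no
  earlier move; \<open>kink_left\<close> starts at N = 1.\<close>

lemma single_move_unknot:
  "equivalent_knots
     (polyline [(1, 2, 0), (1, 0, 0)] \<union>
      polyline [(1, 0, 0), (0, 0, - 1), (- 2, 0, 0), (- 2, - 1, 0), (0, - 1, 0), (0, 0, 0), (- 1, 1, 0), (- 1, 2, 0), (1, 2, 0)])
     (knot_of empty_diagram)"
    (is "equivalent_knots (polyline ?T \<union> polyline ?M) _")
proof -
  let ?kink = "[(1, 0, 0), (0, 0, - 1), (- 2, 0, 0), (- 2, - 1, 0)]"
  let ?kink' = "[(1, 0, 0), (1, - 2, 0), (- 2, - 2, 0), (- 2, - 1, 0)]"
  let ?loop = "[(0, 0, 0), (- 1, 1, 0), (- 1, 2, 0), (1, 2, 0)]"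
  have "equivalent_knots (polyline ?T \<union> polyline ?M) (polyline ?T \<union> polyline (?kink' @ [(0, - 1, 0)] @ ?loop))"
    by (rule closed_move_under[where U="[]" and A="?kink" and B="?kink'" and W="[(0, - 1, 0)] @ ?loop"])
      (simp_all add: check_simps)
  also have "equivalent_knots \<dots> (polyline ?T \<union> polyline ((1, 0, 0) # ?loop))"
    by (rule closed_move_under[where U="[]" and A="?kink' @ [(0, - 1, 0), (0, 0, 0)]" and B="[(1, 0, 0), (0, 0, 0)]" and W="tl ?loop"])
      (simp_all add: check_simps)
  also have "polyline ?T \<union> polyline ((1, 0, 0) # ?loop) = polyline [(1, 0, 0), (0, 0, 0)] \<union> polyline (?loop @ [(1, 0, 0)])"
    by auto
  also have "equivalent_knots \<dots> (polyline [(1, 0, 0), (0, 0, 0)] \<union> polyline [(0, 0, 0), (0, 1, 0), (1, 0, 0)])"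
    by (rule closed_move_under[where U="[]" and A="?loop @ [(1, 0, 0)]" and B="[(0, 0, 0), (0, 1, 0), (1, 0, 0)]" and W="[]"])
      (simp_all add: check_simps)
  also have "\<dots> = knot_of empty_diagram"
    unfolding knot_of_def empty_diagram_def by (auto simp: closed_segment_commute)
  finally show ?thesis .
qed

text \<open>No moves precede the tuck, so there is no prefix to box in. The under-arc through \<ell>
  starts on the right side of the neck loop at (1, 2, 0) and contains a.\<close>

lemma shortest_tuck_unknot:
  "equivalent_knots
     (polyline [(- 1, 2, 0), (- 1, 5, 0), (1, 5, 0), (1, 2, 0)] \<union>
      polyline [(1, 2, 0), (1, 0, 0), (0, 0, - 1), (- 2, 0, 0), (- 2, - 1, 0), (0, - 1, 1), (3, - 1, 0), (3, 3, 0),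
        (1, 3, - 1), (0, 3, 0), (0, 4, 0), (- 1, 4, 1), (- 5, 4, 0), (- 5, - 1/3, 0), (- 2, - 1/3, 1), (- 3/2, - 1/3, 0),
        (- 3/2, - 2/3, 0), (- 2, - 2/3, - 1), (- 5, - 2/3, 0), (- 5, - 4, 0), (0, - 4, 0), (0, - 2/3, 0), (0, 0, 0),
        (- 1, 1, 0), (- 1, 2, 0)])
     (knot_of empty_diagram)"
    (is "equivalent_knots (polyline ?T \<union> polyline ?M) _")
proof -
  let ?loop = "[(1, 2, 0), (1, 0, 0), (0, 0, - 1), (- 2, 0, 0), (- 2, - 1, 0), (0, - 1, 1), (3, - 1, 0), (3, 3, 0),
      (1, 3, - 1), (0, 3, 0)]"
  let ?loop' = "[(1, 2, 0), (0, 3, 0)]"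
  let ?tail = "[(0, 4, 0), (- 1, 4, 1), (- 5, 4, 0), (- 5, - 1/3, 0), (- 2, - 1/3, 1), (- 3/2, - 1/3, 0)]"
  let ?hook = "[(- 3/2, - 2/3, 0), (- 2, - 2/3, - 1), (- 5, - 2/3, 0), (- 5, - 4, 0), (0, - 4, 0), (0, - 2/3, 0)]"
  let ?hook' = "[(- 3/2, - 2/3, 0), (0, - 2/3, 0)]"
  let ?left = "[(0, 0, 0), (- 1, 1, 0), (- 1, 2, 0)]"
  have "equivalent_knots (polyline ?T \<union> polyline ?M) (polyline ?T \<union> polyline (?loop @ ?tail @ ?hook' @ ?left))"
    by (rule closed_move_under[where U="?loop @ ?tail" and A="?hook" and B="?hook'" and W="?left"])
      (simp_all add: check_simps)
  also have "equivalent_knots \<dots> (polyline ?T \<union> polyline (?loop' @ ?tail @ ?hook' @ ?left))"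
    by (rule closed_move_under[where U="[]" and A="?loop" and B="?loop'" and W="?tail @ ?hook' @ ?left"])
      (simp_all add: check_simps)
  also have "equivalent_knots \<dots> (polyline ?T \<union> polyline [(1, 2, 0), (0, 3, 0), (- 1, 2, 0)])"
    by (rule closed_move_over[where U="[(1, 2, 0)]" and A="(0, 3, 0) # ?tail @ ?hook' @ ?left" and B="[(0, 3, 0), (- 1, 2, 0)]" and W="[]"])
      (simp_all add: check_simps)
  \<comment> \<open>No crossing is left. This detour produces an edge of the target triangle, after
    which all other edges form one arc.\<close>
  also have "equivalent_knots \<dots> (polyline ?T \<union> polyline [(1, 2, 0), (1, 0, 0), (0, 0, 0), (- 1, 2, 0)])"
    by (rule closed_move_under[where U="[]" and A="[(1, 2, 0), (0, 3, 0), (- 1, 2, 0)]" and B="[(1, 2, 0), (1, 0, 0), (0, 0, 0), (- 1, 2, 0)]" and W="[]"])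
      (simp_all add: check_simps)
  also have "polyline ?T \<union> polyline [(1, 2, 0), (1, 0, 0), (0, 0, 0), (- 1, 2, 0)] =
      polyline [(1, 0, 0), (0, 0, 0)] \<union> polyline ((0, 0, 0) # ?T @ [(1, 0, 0)])"
    by (auto simp: closed_segment_commute)
  also have "equivalent_knots \<dots> (polyline [(1, 0, 0), (0, 0, 0)] \<union> polyline [(0, 0, 0), (0, 1, 0), (1, 0, 0)])"
    by (rule closed_move_under[where U="[]" and A="(0, 0, 0) # ?T @ [(1, 0, 0)]" and B="[(0, 0, 0), (0, 1, 0), (1, 0, 0)]" and W="[]"])
      (simp_all add: check_simps)
  also have "\<dots> = knot_of empty_diagram"
    unfolding knot_of_def empty_diagram_def by (auto simp: closed_segment_commute)
  finally show ?thesis .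
qed

text \<open>Since \<open>C\<^sub>i\<close> is an over-crossing, freeing the middle part leaves an
  over-arc that starts already at V, and all crossings after V vanish. The sign
  \<open>\<sigma>\<close> is the side from which \<open>C\<^sub>i\<close> enters; \<ell> is on the
  right.\<close>

lemma tuck_after_center:
  fixes N v \<sigma> :: real
  defines "V \<equiv> (\<sigma> * (N + 1), v, 0)" and "D \<equiv> (0, 1/2 - N, 0)" and "E \<equiv> (- 1, N + 1/2, 0)" and "F \<equiv> (1, N + 1/2, 0)"
  assumes N: "1 \<le> N" and v: "1 - N \<le> v" "v \<le> N" and C: "core N [V, D, E, F] C" and \<sigma>: "\<sigma> = 1 \<or> \<sigma> = - 1"
  shows "equivalent_knots
    (C \<union> polyline [E, (- 1, N + 6, 0), (1, N + 6, 0), F] \<union>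
     polyline [V, (\<sigma> * (N + 1), N + 1, 0), (\<sigma>, N + 1, 1), (0, N + 1, 0), (0, N + 2, 0), (1, N + 2, - 1), (N + 3, N + 2, 0),
       (N + 3, - N - 2, 0), (0, - N - 2, 1), (- N - 4, - N - 2, 0), (- N - 4, N + 4, 0), (- 1, N + 4, - 1),
       (0, N + 4, 0), (0, N + 5, 0), (1, N + 5, 1), (N + 6, N + 5, 0), (N + 6, - N - 4/3, 0), (N + 3, - N - 4/3, 1),
       (N + 5/2, - N - 4/3, 0), (N + 5/2, - N - 5/3, 0), (N + 3, - N - 5/3, - 1), (N + 6, - N - 5/3, 0),
       (N + 6, - N - 5, 0), (0, - N - 5, 0), D])
    (C \<union> polyline [E, (- 1, N + 1, 0), (1, N + 1, 0), F] \<union>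
     polyline [V, (\<sigma> * (N + 1), - N, 0), (0, - N, 0), D])"
    (is "equivalent_knots (C \<union> polyline ?T \<union> polyline ?M) (C \<union> polyline ?T' \<union> polyline ?M')")
proof -
  note defs = V_def D_def E_def F_def
  let ?start = "[V, (\<sigma> * (N + 1), N + 1, 0), (\<sigma>, N + 1, 1), (0, N + 1, 0)]"
  let ?loop = "[(0, N + 2, 0), (1, N + 2, - 1), (N + 3, N + 2, 0), (N + 3, - N - 2, 0), (0, - N - 2, 1),
      (- N - 4, - N - 2, 0), (- N - 4, N + 4, 0), (- 1, N + 4, - 1), (0, N + 4, 0)]"
  let ?loop' = "[(0, N + 2, 0), (0, N + 4, 0)]"
  let ?tail = "[(0, N + 5, 0), (1, N + 5, 1), (N + 6, N + 5, 0), (N + 6, - N - 4/3, 0), (N + 3, - N - 4/3, 1),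
      (N + 5/2, - N - 4/3, 0)]"
  let ?hook = "[(N + 5/2, - N - 5/3, 0), (N + 3, - N - 5/3, - 1), (N + 6, - N - 5/3, 0), (N + 6, - N - 5, 0),
      (0, - N - 5, 0), D]"
  let ?hook' = "[(N + 5/2, - N - 5/3, 0), (0, - N - 5/3, 0), D]"
  have "equivalent_knots (C \<union> polyline ?T \<union> polyline ?M)
      (C \<union> polyline ?T \<union> polyline (?start @ ?loop @ ?tail @ ?hook'))"
    by (rule active_move_under[OF C, where U="?start @ ?loop @ ?tail" and A="?hook" and B="?hook'" and W="[]"])
      (insert N v \<sigma>, (elim disjE; simp add: check_simps defs)+)
  \<comment> \<open>The shortened end no longer passes \<open>L\<^sub>i\<close>, so this arc has
    only the under-crossings of \<open>R\<^sub>o\<close>, t2 and \<open>C\<^sub>o\<close>.\<close>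
  also have "equivalent_knots \<dots> (C \<union> polyline ?T \<union> polyline (?start @ ?loop' @ ?tail @ ?hook'))"
    by (rule active_move_under[OF C, where U="?start" and A="?loop" and B="?loop'" and W="?tail @ ?hook'"])
      (insert N v \<sigma>, (elim disjE; simp add: check_simps defs)+)
  \<comment> \<open>Only \<open>C\<^sub>i\<close> and t1 are left, both over.\<close>
  also have "equivalent_knots \<dots> (C \<union> polyline ?T \<union> polyline ?M')"
    by (rule active_move_over[OF C, where U="[]" and A="?start @ ?loop' @ ?tail @ ?hook'" and B="?M'" and W="[]"])
      (insert N v \<sigma>, (elim disjE; simp add: check_simps defs)+)
  also have "equivalent_knots \<dots> (C \<union> polyline ?T' \<union> polyline ?M')"
    by (rule loop_move_under[OF C, where U="[]" and A="?T" and B="?T'" and W="[]"])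
      (insert N v \<sigma>, (elim disjE; simp add: check_simps defs)+)
  finally show ?thesis .
qed

section \<open>Tie diagrams\<close>

lemma core_cong: "set Zs = set Zs' \<Longrightarrow> core N Zs C \<longleftrightarrow> core N Zs' C"
  by (simp add: core_def)

abbreviation loop_top :: "real \<Rightarrow> real \<Rightarrow> point3 list" where
  "loop_top N h \<equiv> [(- 1, N + 1/2, 0), (- 1, h, 0), (1, h, 0), (1, N + 1/2, 0)]"

lemma mirror_loop_top:
  "polyline (map mirror_x (loop_top N h)) = polyline (loop_top N h)"
  "polyline (map mirror_z (loop_top N h)) = polyline (loop_top N h)"
  using polyline_rev[of "loop_top N h"] by simp_all

text \<open>The reduction is required for every core because it is applied to the reflected one.
  Reflection interchanges the attachment points on the neck loop and reverses its top, which leaves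
  the sets unchanged.\<close>

lemma mirror_reduction_x:
  assumes reduction: "\<And>C. core N [(a, v, 0), (0, c, 0), (- 1, N + 1/2, 0), (1, N + 1/2, 0)] C \<Longrightarrow>
      equivalent_knots (C \<union> polyline (loop_top N h) \<union> polyline M) (C \<union> polyline (loop_top N h') \<union> polyline M')"
    and C: "core N [(- a, v, 0), (0, c, 0), (- 1, N + 1/2, 0), (1, N + 1/2, 0)] C"
  shows "equivalent_knots (C \<union> polyline (loop_top N h) \<union> polyline (map mirror_x M))
           (C \<union> polyline (loop_top N h') \<union> polyline (map mirror_x M'))"
proof -
  let ?C = "mirror_x ` C"
  have "core N [(a, v, 0), (0, c, 0), (- 1, N + 1/2, 0), (1, N + 1/2, 0)] ?C"
    using core_mirror(2)[OF C] by (rule iffD1[OF core_cong, rotated]) auto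
  from reduction[OF this]
  have "equivalent_knots (mirror_x ` (?C \<union> polyline (loop_top N h) \<union> polyline M))
      (mirror_x ` (?C \<union> polyline (loop_top N h') \<union> polyline M'))"
    unfolding equivalent_knots_mirror(1) .
  then show ?thesis
    unfolding image_Un mirror_polyline mirror_loop_top by (simp only: image_image mirror_mirror image_ident)
qed

lemma mirror_reduction_z:
  assumes reduction: "\<And>C. core N [(a, v, 0), (0, c, 0), (- 1, N + 1/2, 0), (1, N + 1/2, 0)] C \<Longrightarrow>
      equivalent_knots (C \<union> polyline (loop_top N h) \<union> polyline M) (C \<union> polyline (loop_top N h') \<union> polyline M')"
    and C: "core N [(a, v, 0), (0, c, 0), (- 1, N + 1/2, 0), (1, N + 1/2, 0)] C"
  shows "equivalent_knots (C \<union> polyline (loop_top N h) \<union> polyline (map mirror_z M))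
           (C \<union> polyline (loop_top N h') \<union> polyline (map mirror_z M'))"
proof -
  let ?C = "mirror_z ` C"
  have "core N [(a, v, 0), (0, c, 0), (- 1, N + 1/2, 0), (1, N + 1/2, 0)] ?C"
    using core_mirror(1)[OF C] by simp
  from reduction[OF this]
  have "equivalent_knots (mirror_z ` (?C \<union> polyline (loop_top N h) \<union> polyline M))
      (mirror_z ` (?C \<union> polyline (loop_top N h') \<union> polyline M'))"
    unfolding equivalent_knots_mirror(2) .
  then show ?thesis
    unfolding image_Un mirror_polyline mirror_loop_top by (simp only: image_image mirror_mirror image_ident)
qed

section \<open>The prefix of a tie diagram lies in its box\<close>

lemma active_strand_append:
  "active_strand k r (xs @ ys) =
     active_strand k r xs @ active_strand (k + length xs) (if xs = [] then r else region_of (last xs)) ys"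
proof (induction xs arbitrary: k r)
  case (Cons m xs)
  then show ?case by (cases m) (auto simp: Let_def split: prod.splits)
qed simp

lemma crossing_bounds: "\<bar>fst (crossing r r' k)\<bar> \<le> 1" "- real k \<le> snd (crossing r r' k)" "snd (crossing r r' k) \<le> real k + 1"
  by (auto simp: crossing_def)

lemma column_bound: "\<bar>column r k\<bar> \<le> real k + 1"
  by (cases r) auto

lemma active_strand_bounds:
  assumes "w \<in> set (active_strand k r ms)"
  shows "\<bar>fst w\<bar> \<le> real (k + length ms) + 1 \<and> 1 - real (k + length ms) \<le> fst (snd w) \<and>
    fst (snd w) \<le> real (k + length ms)"
  using assms
proof (induction ms arbitrary: k r)
  case (Cons m ms)
  obtain r' d where m: "m = Move r' d" by (cases m)
  obtain x y where xy: "crossing r r' k = (x, y)" by (cases "crossing r r' k")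
  have "\<bar>x\<bar> \<le> 1" "- real k \<le> y" "y \<le> real k + 1"
    using crossing_bounds[where r=r and r'=r' and k=k] unfolding xy by simp_all
  moreover have "\<bar>column r k\<bar> \<le> real k + 1" "\<bar>column r' (k + 1)\<bar> \<le> real k + 2"
    using column_bound[of r k] column_bound[of r' "k + 1"] by simp_all
  moreover have "w = (column r k, y, 0) \<or> w = (x, y, level d) \<or> w = (column r' (k + 1), y, 0) \<or>
      w \<in> set (active_strand (k + 1) r' ms)"
    using Cons.prems unfolding m by (simp add: xy)
  ultimately show ?case
    using Cons.IH[of "k + 1" r'] by (elim disjE) simp_all
qed simp

lemma box_segment:
  fixes w p q :: point3
  assumes "w \<in> closed_segment p q"
    and "\<bar>fst p\<bar> \<le> a" "b \<le> fst (snd p)" "fst (snd p) \<le> c"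
    and "\<bar>fst q\<bar> < a" "b < fst (snd q)" "fst (snd q) < c"
  shows "\<bar>fst w\<bar> < a \<and> b < fst (snd w) \<and> fst (snd w) < c \<or> w = p"
proof -
  obtain u where u: "0 \<le> u" "u \<le> 1" "w = (1 - u) *\<^sub>R p + u *\<^sub>R q"
    using assms(1) unfolding in_segment by blast
  show ?thesis
  proof (cases "u = 0")
    case False
    have less: "(1 - u) * s + u * t < d" if "s \<le> d" "t < d" for s t d
    proof -
      have "(1 - u) * s \<le> (1 - u) * d" using u that by (intro mult_left_mono) auto
      moreover have "u * t < u * d" using u False that by simp
      ultimately show ?thesis by (simp add: algebra_simps)
    qed
    have "(1 - u) * - s + u * - t < - d" if "d \<le> s" "d < t" for s t d
      using less[of "- s" "- d" "- t"] that by simp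
    then have greater: "d < (1 - u) * s + u * t" if "d \<le> s" "d < t" for s t d
      using that by fastforce
    have "\<bar>fst w\<bar> < a"
      unfolding u(3) using less[of "fst p" a "fst q"] greater[of "- a" "fst p" "fst q"] assms(2,5) by (simp add: abs_less_iff abs_le_iff)
    moreover have "b < fst (snd w)" "fst (snd w) < c"
      unfolding u(3) using less[of "fst (snd p)" c "fst (snd q)"] greater[of b "fst (snd p)" "fst (snd q)"] assms by simp_all
    ultimately show ?thesis by blast
  qed (use u in simp)
qed

lemma convex_box: "convex {w :: point3. \<bar>fst w\<bar> \<le> a \<and> b \<le> fst (snd w) \<and> fst (snd w) \<le> c}"
proof -
  have "{w :: point3. \<bar>fst w\<bar> \<le> a \<and> b \<le> fst (snd w) \<and> fst (snd w) \<le> c} = {- a..a} \<times> {b..c} \<times> UNIV"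
    by (auto simp: abs_le_iff)
  then show ?thesis by (simp add: convex_Times)
qed

definition prefix_core :: "move list \<Rightarrow> point3 set" where
  "prefix_core ms =
     (let N = real (length ms) in
      polyline [(0, 1/2 - N, 0), (0, 0, 0), (- 1, 1, 0), (- 1, N + 1/2, 0)] \<union>
      polyline [(1, N + 1/2, 0), (1, 0, 0)] \<union> polyline (active_strand 0 Right ms))"

text \<open>The height of the last crossing of the prefix, called v in the geometric lemmas, which
  use only its bounds 1 - N and N.\<close>

definition exit_height :: "move list \<Rightarrow> real" where
  "exit_height ms = fst (snd (last (active_strand 0 Right ms)))"

text \<open>Arcs that follow fewer than N crossings use columns of absolute value at most N, so only
  the last vertex can lie on the boundary of the box.\<close>

lemma active_strand_snoc:
  assumes "ms \<noteq> []"
  obtains A q where "active_strand 0 Right ms = A @ [q, (column (region_of (last ms)) (length ms), exit_height ms, 0)]"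
    "\<And>w. w \<in> set (A @ [q]) \<Longrightarrow> \<bar>fst w\<bar> \<le> real (length ms) \<and> 1 - real (length ms) \<le> fst (snd w) \<and> fst (snd w) \<le> real (length ms)"
    "1 - real (length ms) \<le> exit_height ms" "exit_height ms \<le> real (length ms)"
proof -
  obtain ms' r' d where ms: "ms = ms' @ [Move r' d]"
    using assms by (metis move.exhaust rev_exhaust)
  define r where "r = (if ms' = [] then Right else region_of (last ms'))"
  obtain x y where xy: "crossing r r' (length ms') = (x, y)" by (cases "crossing r r' (length ms')")
  have bounds: "\<bar>x\<bar> \<le> 1" "- real (length ms') \<le> y" "y \<le> real (length ms') + 1"
    using crossing_bounds[where r=r and r'=r' and k="length ms'"] unfolding xy by simp_all
  have eq: "active_strand 0 Right ms =
     (active_strand 0 Right ms' @ [(column r (length ms'), y, 0)]) @ [(x, y, level d), (column r' (length ms), y, 0)]"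
    unfolding ms active_strand_append by (simp add: r_def[symmetric] xy)
  then have y: "exit_height ms = y" unfolding exit_height_def by simp
  have reg: "region_of (last ms) = r'" using ms by simp
  show thesis
  proof (rule that)
    show "active_strand 0 Right ms = (active_strand 0 Right ms' @ [(column r (length ms'), y, 0)]) @
        [(x, y, level d), (column (region_of (last ms)) (length ms), exit_height ms, 0)]"
      using eq y reg by simp
    fix w assume "w \<in> set ((active_strand 0 Right ms' @ [(column r (length ms'), y, 0)]) @ [(x, y, level d)])"
    then consider "w \<in> set (active_strand 0 Right ms')" | "w = (column r (length ms'), y, 0)" | "w = (x, y, level d)" by auto
    then show "\<bar>fst w\<bar> \<le> real (length ms) \<and> 1 - real (length ms) \<le> fst (snd w) \<and> fst (snd w) \<le> real (length ms)"
    proof cases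
      case 1
      then show ?thesis using active_strand_bounds[OF 1] unfolding ms by simp
    qed (use bounds column_bound[of r "length ms'"] in \<open>simp_all add: ms\<close>)
  qed (use bounds y in \<open>simp_all add: ms\<close>)
qed

lemma prefix_core:
  assumes "ms \<noteq> []" "N = real (length ms)"
  shows "core N [(column (region_of (last ms)) (length ms), exit_height ms, 0), (0, 1/2 - N, 0), (- 1, N + 1/2, 0), (1, N + 1/2, 0)]
    (prefix_core ms)"
proof -
  obtain A q where A: "active_strand 0 Right ms = A @ [q, (column (region_of (last ms)) (length ms), exit_height ms, 0)]"
    "\<And>w. w \<in> set (A @ [q]) \<Longrightarrow> \<bar>fst w\<bar> \<le> N \<and> 1 - N \<le> fst (snd w) \<and> fst (snd w) \<le> N"
    "1 - N \<le> exit_height ms" "exit_height ms \<le> N"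
    using active_strand_snoc[OF assms(1)] unfolding assms(2) by metis
  have N: "1 \<le> N" using assms by (cases ms) auto
  define V where "V = (column (region_of (last ms)) (length ms), exit_height ms, 0 :: real)"
  let ?box = "\<lambda>w :: point3. \<bar>fst w\<bar> < N + 1 \<and> 1/2 - N < fst (snd w) \<and> fst (snd w) < N + 1/2"
  have seg: "?box w \<or> w = p" if "w \<in> closed_segment p q" "\<bar>fst p\<bar> \<le> N + 1" "1/2 - N \<le> fst (snd p)" "fst (snd p) \<le> N + 1/2" "?box q" for w p q
    using box_segment[OF that(1-4)] that(5) by blast
  have strand: "?box w \<or> w = V" if "w \<in> polyline (A @ [q, V])" for w
  proof (cases "w \<in> polyline (A @ [q])")
    case True
    have "polyline (A @ [q]) \<subseteq> {w. \<bar>fst w\<bar> \<le> N \<and> 1 - N \<le> fst (snd w) \<and> fst (snd w) \<le> N}"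
      by (rule polyline_subset[OF convex_box]) (use A(2) in blast)
    then show ?thesis using True by fastforce
  next
    case False
    then have "w \<in> closed_segment V q"
      using that unfolding polyline_append[of A q "[V]"] by (simp add: closed_segment_commute)
    moreover have "\<bar>fst V\<bar> \<le> N + 1" using column_bound[of "region_of (last ms)" "length ms"] by (simp add: V_def assms(2))
    ultimately show ?thesis
      using seg[of w V q] A(2)[of q] A(3,4) N unfolding V_def by simp
  qed
  have strand_ends: "?box w \<or> w = (0, 1/2 - N, 0) \<or> w = (- 1, N + 1/2, 0) \<or> w = (1, N + 1/2, 0)"
    if "w \<in> polyline [(0, 1/2 - N, 0), (0, 0, 0), (- 1, 1, 0), (- 1, N + 1/2, 0)] \<union> polyline [(1, N + 1/2, 0), (1, 0, 0)]" for w
  proof -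
    from that consider "w \<in> closed_segment (0, 1/2 - N, 0) (0, 0, 0)" | "w \<in> closed_segment (0, 0, 0) (- 1, 1, 0)" |
        "w \<in> closed_segment (- 1, N + 1/2, 0) (- 1, 1, 0)" | "w \<in> closed_segment (1, N + 1/2, 0) (1, 0, 0)"
      by (auto simp: closed_segment_commute)
    then show ?thesis
    proof cases
      case 1
      then show ?thesis using seg[OF 1] N by simp blast
    next
      case 2
      then show ?thesis using seg[OF 2] N by auto
    next
      case 3
      then show ?thesis using seg[OF 3] N by auto
    next
      case 4
      then show ?thesis using seg[OF 4] N by auto
    qed
  qed
  show ?thesis
    unfolding core_def V_def[symmetric]
  proof
    show "segment_union (prefix_core ms)" unfolding prefix_core_def Let_def by simp
    show "\<forall>w\<in>prefix_core ms. ?box w \<or> w \<in> set [V, (0, 1/2 - N, 0), (- 1, N + 1/2, 0), (1, N + 1/2, 0)]"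
    proof
      fix w assume "w \<in> prefix_core ms"
      then consider "w \<in> polyline [(0, 1/2 - N, 0), (0, 0, 0), (- 1, 1, 0), (- 1, N + 1/2, 0)] \<union> polyline [(1, N + 1/2, 0), (1, 0, 0)]"
        | "w \<in> polyline (A @ [q, V])"
        unfolding prefix_core_def Let_def A(1) V_def assms(2) by blast
      then show "?box w \<or> w \<in> set [V, (0, 1/2 - N, 0), (- 1, N + 1/2, 0), (1, N + 1/2, 0)]"
      proof cases
        case 1
        from strand_ends[OF 1] show ?thesis unfolding list.set by blast
      next
        case 2
        from strand[OF 2] show ?thesis unfolding list.set by blast
      qed
    qed
  qed
qed

text \<open>Cuts the closed polygon at V, D, E and F. The piece of its first edge from b up to D is
  moved behind the active strand, so that everything from V to D forms one polyline.\<close>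

lemma knot_decompose:
  assumes ms: "ms \<noteq> []" "region_of (hd ms) = Left" and N: "N = real (length ms)" "length ms \<le> m"
  shows "knot_of (passive_strand m @ active_strand 0 Right ms @ W) =
    prefix_core ms \<union> polyline (loop_top N (real m + 1)) \<union>
    polyline ((column (region_of (last ms)) (length ms), exit_height ms, 0) # W @ [(0, - real m, 0), (0, 1/2 - N, 0)])"
proof -
  obtain A q where A: "active_strand 0 Right ms = A @ [q, (column (region_of (last ms)) (length ms), exit_height ms, 0)]"
    using active_strand_snoc[OF ms(1)] by metis
  define V where "V = (column (region_of (last ms)) (length ms), exit_height ms, 0 :: real)"
  \<comment> \<open>The active strand starts at a because the first move is an L move from
    \<open>Right\<close>, whose crossing has height 0.\<close>
  obtain S where S: "active_strand 0 Right ms = (1, 0, 0) # S"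
    using ms by (cases ms; cases "hd ms") (auto simp: Let_def crossing_def doubleton_eq_iff)
  let ?D = "(0, 1/2 - N, 0) :: point3" and ?b = "(0, - real m, 0) :: point3"
  let ?E = "(- 1, N + 1/2, 0) :: point3" and ?F = "(1, N + 1/2, 0) :: point3"
  let ?E' = "(- 1, real m + 1, 0) :: point3" and ?F' = "(1, real m + 1, 0) :: point3"
  have Nm: "1 \<le> N" "N \<le> real m" using ms N by (cases ms; simp)+
  have "?D \<in> closed_segment ?b (0, 0, 0)" "?E \<in> closed_segment (- 1, 1, 0) ?E'" "?F \<in> closed_segment ?F' (1, 0, 0)"
    using Nm by (intro in_vertical_segment; simp)+
  then have splits: "closed_segment ?b (0, 0, 0) = closed_segment ?b ?D \<union> closed_segment ?D (0, 0, 0)"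
    "closed_segment (- 1, 1, 0) ?E' = closed_segment (- 1, 1, 0) ?E \<union> closed_segment ?E ?E'"
    "closed_segment ?F' (1, 0, 0) = closed_segment ?F' ?F \<union> closed_segment ?F (1, 0, 0)"
    using Un_closed_segment by metis+
  have "knot_of (passive_strand m @ active_strand 0 Right ms @ W) =
      polyline ([?b, (0, 0, 0), (- 1, 1, 0), ?E', ?F'] @ (1, 0, 0) # S @ W @ [?b])"
    unfolding knot_of_def passive_strand_def S by simp
  also have "\<dots> = polyline [?b, (0, 0, 0), (- 1, 1, 0), ?E', ?F', (1, 0, 0)] \<union> polyline ((1, 0, 0) # S @ W @ [?b])"
    unfolding polyline_append[of "[?b, (0, 0, 0), (- 1, 1, 0), ?E', ?F']" "(1, 0, 0)" "S @ W @ [?b]"] by simp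
  also have "(1, 0, 0) # S @ W @ [?b] = (A @ [q]) @ V # W @ [?b]"
    using S A unfolding V_def by simp
  also have "polyline \<dots> = polyline (active_strand 0 Right ms) \<union> polyline (V # W @ [?b])"
    using polyline_append[of "A @ [q]" V "W @ [?b]"] unfolding A V_def[symmetric] by simp
  finally have "knot_of (passive_strand m @ active_strand 0 Right ms @ W) =
      polyline [?b, (0, 0, 0), (- 1, 1, 0), ?E', ?F', (1, 0, 0)] \<union> polyline (active_strand 0 Right ms) \<union> polyline (V # W @ [?b])"
    by (simp only: Un_assoc)
  moreover have "polyline (V # W @ [?b, ?D]) = polyline (V # W @ [?b]) \<union> closed_segment ?b ?D"
    using polyline_append[of "V # W" ?b "[?D]"] by simp
  ultimately show ?thesis
    unfolding prefix_core_def Let_def V_def[symmetric] N(1)[symmetric]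
    by (simp only: polyline.simps splits Un_empty_right) (auto simp: closed_segment_commute)
qed

text \<open>Separates geometry from list arithmetic: the vertices computed from a tie word are
  matched with those of a geometric lemma by simplification.\<close>

lemma equivalent_knots_cong:
  assumes "equivalent_knots (C \<union> polyline T \<union> polyline M) (C \<union> polyline T' \<union> polyline M')"
    and "K = C \<union> polyline S \<union> polyline L" "K' = C \<union> polyline S' \<union> polyline L'"
    and "S = T" "L = M" "S' = T'" "L' = M'"
  shows "equivalent_knots K K'"
  using assms by simp

lemma knot_of_plain:
  assumes "ms \<noteq> []" "region_of (hd ms) = Left"
  shows "knot_of (tie_diagram (Plain (ms @ ws))) =
    prefix_core ms \<union> polyline (loop_top (real (length ms)) (real (length (ms @ ws)) + 1)) \<union>
    polyline ((column (region_of (last ms)) (length ms), exit_height ms, 0) #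
      (active_strand (length ms) (region_of (last ms)) ws @
        [(column (region_of (last (ms @ ws))) (length (ms @ ws)), - real (length (ms @ ws)), 0)]) @
      [(0, - real (length (ms @ ws)), 0), (0, 1/2 - real (length ms), 0)])"
proof -
  have "tie_diagram (Plain (ms @ ws)) = passive_strand (length (ms @ ws)) @ active_strand 0 Right ms @
      (active_strand (length ms) (region_of (last ms)) ws @
        [(column (region_of (last (ms @ ws))) (length (ms @ ws)), - real (length (ms @ ws)), 0)])"
    using assms(1) by (simp add: Let_def active_strand_append)
  then show ?thesis
    using knot_decompose[OF assms refl, of "length (ms @ ws)"] by (simp only: length_append le_add1)
qed

lemma knot_of_tucked:
  assumes "ms \<noteq> []" "region_of (hd ms) = Left"
    and n: "n = length (ms @ ws)" and r: "r = region_of ((ms @ ws) ! (n - 3))"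
  shows "knot_of (tie_diagram (Tucked (ms @ ws))) =
    prefix_core ms \<union> polyline (loop_top (real (length ms)) (real (n + 1) + 1)) \<union>
    polyline ((column (region_of (last ms)) (length ms), exit_height ms, 0) #
      (active_strand (length ms) (region_of (last ms)) (ws @ [Move r In]) @ tuck_hook r n @
        [(column r (n + 1), - real (n + 1), 0)]) @
      [(0, - real (n + 1), 0), (0, 1/2 - real (length ms), 0)])"
proof -
  have "tie_diagram (Tucked (ms @ ws)) = passive_strand (n + 1) @ active_strand 0 Right ms @
      (active_strand (length ms) (region_of (last ms)) (ws @ [Move r In]) @ tuck_hook r n @
        [(column r (n + 1), - real (n + 1), 0)])"
    using assms(1) unfolding tie_diagram.simps Let_def n[symmetric] r[symmetric] append_assoc
    by (simp add: active_strand_append)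
  then show ?thesis
    using knot_decompose[OF assms(1,2) refl, of "n + 1"] n by simp
qed

lemma length_bounds: "ms \<noteq> [] \<Longrightarrow> 1 \<le> real (length ms)"
  by (cases ms) auto

lemma exit_height_bounds:
  assumes "ms \<noteq> []"
  shows "1 - real (length ms) \<le> exit_height ms" "exit_height ms \<le> real (length ms)"
  using active_strand_snoc[OF assms] by metis+

lemmas crossing_simps = crossing_def doubleton_eq_iff tuck_hook_def Let_def

section \<open>Reductions of tie sequences\<close>

lemma remove_kink:
  assumes ms: "ms \<noteq> []" "region_of (hd ms) = Left"
    and regions: "region_of (last ms) \<noteq> Center" "r \<noteq> Center" "r \<noteq> region_of (last ms)"
  shows "equivalent_diagrams (tie_diagram (Plain (ms @ [Move r d]))) (tie_diagram (Plain ms))"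
proof -
  define N where "N = real (length ms)"
  define v where "v = exit_height ms"
  note bounds = length_bounds[OF ms(1), folded N_def] exit_height_bounds[OF ms(1), folded N_def v_def]
  note kink = kink_left[OF bounds]
  note kink_z = mirror_reduction_z[OF kink]
  note core = prefix_core[OF ms(1) N_def]
  \<comment> \<open>The right column is written as the negative of the left one, the form in which
    \<open>mirror_reduction_x\<close> expects it.\<close>
  have column: "column Left (length ms) = - N - 1" "column Right (length ms) = - (- N - 1)"
    by (simp_all add: N_def)
  note decompose = knot_of_plain[OF ms, of "[Move r d]"] knot_of_plain[OF ms, of "[]", unfolded append_Nil2]
  consider "region_of (last ms) = Left" "r = Right" "d = Out" | "region_of (last ms) = Left" "r = Right" "d = In" |
    "region_of (last ms) = Right" "r = Left" "d = Out" | "region_of (last ms) = Right" "r = Left" "d = In"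
    using regions by (cases "region_of (last ms)"; cases r; cases d) auto
  then have "equivalent_knots (knot_of (tie_diagram (Plain (ms @ [Move r d])))) (knot_of (tie_diagram (Plain ms)))"
  proof cases
    case 1
    note C = core[unfolded 1 column, folded v_def]
    show ?thesis
      by (rule equivalent_knots_cong[OF kink[OF C] decompose]) (simp_all add: 1 N_def v_def crossing_simps)
  next
    case 2
    note C = core[unfolded 2 column, folded v_def]
    show ?thesis
      by (rule equivalent_knots_cong[OF kink_z[OF _ C] decompose]) (simp_all add: 2 N_def v_def crossing_simps)
  next
    case 3
    note C = core[unfolded 3 column, folded v_def]
    show ?thesis
      by (rule equivalent_knots_cong[OF mirror_reduction_x[OF kink C] decompose]) (simp_all add: 3 N_def v_def crossing_simps)
  next
    case 4
    note C = core[unfolded 4 column, folded v_def]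
    show ?thesis
      by (rule equivalent_knots_cong[OF mirror_reduction_x[OF kink_z C] decompose]) (simp_all add: 4 N_def v_def crossing_simps)
  qed
  then show ?thesis unfolding equivalent_diagrams_def .
qed

lemma reduce_tuck_after_left:
  assumes "region_of (hd (p @ [L\<^sub>i])) = Left"
  shows "equivalent_diagrams (tie_diagram (Tucked (p @ [L\<^sub>i, R\<^sub>o, L\<^sub>i, C\<^sub>o]))) (tie_diagram (Plain (p @ [L\<^sub>i, C\<^sub>o, R\<^sub>i])))"
proof -
  \<comment> \<open>The preceding \<open>L\<^sub>i\<close> belongs to the prefix, which is therefore
    nonempty even if p is empty.\<close>
  define ms where "ms = p @ [L\<^sub>i]"
  define N where "N = real (length ms)"
  define v where "v = exit_height ms"
  have ms: "ms \<noteq> []" "region_of (hd ms) = Left" "region_of (last ms) = Left" using assms by (simp_all add: ms_def)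
  note bounds = length_bounds[OF ms(1), folded N_def] exit_height_bounds[OF ms(1), folded N_def v_def]
  have column: "column Left (length ms) = - N - 1" by (simp add: N_def)
  note C = prefix_core[OF ms(1) N_def, unfolded ms(3) column, folded v_def]
  have words: "p @ [L\<^sub>i, R\<^sub>o, L\<^sub>i, C\<^sub>o] = ms @ [R\<^sub>o, L\<^sub>i, C\<^sub>o]" "p @ [L\<^sub>i, C\<^sub>o, R\<^sub>i] = ms @ [C\<^sub>o, R\<^sub>i]"
    by (simp_all add: ms_def)
  show ?thesis
    unfolding equivalent_diagrams_def words
    by (rule equivalent_knots_cong[OF tuck_after_straight_left[OF bounds C]
          knot_of_tucked[OF ms(1,2) refl refl] knot_of_plain[OF ms(1,2)]])
      (simp_all add: ms N_def v_def crossing_simps nth_append)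
qed

lemma reduce_tuck_after_right:
  assumes "region_of (hd (p @ [R\<^sub>i])) = Left"
  shows "equivalent_diagrams (tie_diagram (Tucked (p @ [R\<^sub>i, L\<^sub>o, R\<^sub>i, C\<^sub>o]))) (tie_diagram (Plain (p @ [R\<^sub>i, C\<^sub>o, L\<^sub>i])))"
proof -
  define ms where "ms = p @ [R\<^sub>i]"
  define N where "N = real (length ms)"
  define v where "v = exit_height ms"
  have ms: "ms \<noteq> []" "region_of (hd ms) = Left" "region_of (last ms) = Right" using assms by (simp_all add: ms_def)
  note bounds = length_bounds[OF ms(1), folded N_def] exit_height_bounds[OF ms(1), folded N_def v_def]
  have column: "column Right (length ms) = - (- N - 1)" by (simp add: N_def)
  note C = prefix_core[OF ms(1) N_def, unfolded ms(3) column, folded v_def]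
  have words: "p @ [R\<^sub>i, L\<^sub>o, R\<^sub>i, C\<^sub>o] = ms @ [L\<^sub>o, R\<^sub>i, C\<^sub>o]" "p @ [R\<^sub>i, C\<^sub>o, L\<^sub>i] = ms @ [C\<^sub>o, L\<^sub>i]"
    by (simp_all add: ms_def)
  show ?thesis
    unfolding equivalent_diagrams_def words
    by (rule equivalent_knots_cong[OF mirror_reduction_x[OF tuck_after_straight_left[OF bounds] C]
          knot_of_tucked[OF ms(1,2) refl refl] knot_of_plain[OF ms(1,2)]])
      (simp_all add: ms N_def v_def crossing_simps nth_append)
qed

lemma reduce_tuck_after_center:
  assumes p: "p \<noteq> []" "region_of (hd p) = Left" "region_of (last p) \<noteq> Center"
    and w: "w = [C\<^sub>i, R\<^sub>o, L\<^sub>i, C\<^sub>o] \<or> w = [C\<^sub>i, L\<^sub>o, R\<^sub>i, C\<^sub>o]"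
  shows "equivalent_diagrams (tie_diagram (Tucked (p @ w))) (tie_diagram (Plain p))"
proof -
  define N where "N = real (length p)"
  define v where "v = exit_height p"
  note bounds = length_bounds[OF p(1), folded N_def] exit_height_bounds[OF p(1), folded N_def v_def]
  \<comment> \<open>The sign is that of the side on which p ends, seen after the reflection in the
    cases where \<ell> is on the left. The columns are written in the four forms that then
    occur.\<close>
  have signs: "(1 :: real) = 1 \<or> (1 :: real) = - 1" "(- 1 :: real) = 1 \<or> (- 1 :: real) = - 1" by simp_all
  have column: "column Left (length p) = - 1 * (N + 1)" "column Right (length p) = 1 * (N + 1)"
    "column Left (length p) = - (1 * (N + 1))" "column Right (length p) = - (- 1 * (N + 1))"
    by (simp_all add: N_def)
  note core = prefix_core[OF p(1) N_def, folded v_def]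
  note decompose = knot_of_tucked[OF p(1,2) refl refl, of w] knot_of_plain[OF p(1,2), of "[]", unfolded append_Nil2]
  consider "region_of (last p) = Left" "w = [C\<^sub>i, R\<^sub>o, L\<^sub>i, C\<^sub>o]" | "region_of (last p) = Right" "w = [C\<^sub>i, R\<^sub>o, L\<^sub>i, C\<^sub>o]" |
    "region_of (last p) = Left" "w = [C\<^sub>i, L\<^sub>o, R\<^sub>i, C\<^sub>o]" | "region_of (last p) = Right" "w = [C\<^sub>i, L\<^sub>o, R\<^sub>i, C\<^sub>o]"
    using p(3) w by (cases "region_of (last p)") auto
  then have "equivalent_knots (knot_of (tie_diagram (Tucked (p @ w)))) (knot_of (tie_diagram (Plain p)))"
  proof cases
    case 1
    note C = core[unfolded 1 column(1)]
    show ?thesis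
      by (rule equivalent_knots_cong[OF tuck_after_center[OF bounds C signs(2)] decompose])
        (simp_all add: 1 N_def v_def crossing_simps nth_append)
  next
    case 2
    note C = core[unfolded 2 column(2)]
    show ?thesis
      by (rule equivalent_knots_cong[OF tuck_after_center[OF bounds C signs(1)] decompose])
        (simp_all add: 2 N_def v_def crossing_simps nth_append)
  next
    case 3
    note C = core[unfolded 3 column(3)]
    show ?thesis
      by (rule equivalent_knots_cong[OF mirror_reduction_x[OF tuck_after_center[OF bounds _ signs(1)] C] decompose])
        (simp_all add: 3 N_def v_def crossing_simps nth_append)
  next
    case 4
    note C = core[unfolded 4 column(4)]
    show ?thesis
      by (rule equivalent_knots_cong[OF mirror_reduction_x[OF tuck_after_center[OF bounds _ signs(2)] C] decompose])
        (simp_all add: 4 N_def v_def crossing_simps nth_append)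
  qed
  then show ?thesis unfolding equivalent_diagrams_def .
qed

text \<open>Moves are peeled off at the end: an L or R move that follows one on the other side makes
  the lowest crossing of the straight strand, a kink. The first move of f has no such predecessor
  inside f and remains.\<close>

lemma remove_kinks:
  assumes "alternating_left_right f" "region_of (hd (p @ f)) = Left"
  shows "equivalent_diagrams (tie_diagram (Plain (p @ f))) (tie_diagram (Plain (p @ [hd f])))"
  using assms
proof (induction f rule: rev_induct)
  case Nil
  then show ?case by (simp add: alternating_left_right_def)
next
  case (snoc m f)
  show ?case
  proof (cases "f = []")
    case True
    then show ?thesis by (simp add: equivalent_diagrams_def equivalent_knots_refl)
  next
    case False
    have alt: "alternating_left_right f" and m: "region_of m \<noteq> Center" "region_of m \<noteq> region_of (last f)"
      using snoc.prems(1) False unfolding alternating_left_right_def by (auto simp: successively_append_iff)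
    have last: "region_of (last f) \<noteq> Center"
      using snoc.prems(1) last_in_set[OF False] unfolding alternating_left_right_def by fastforce
    have hd: "region_of (hd (p @ f)) = Left" using snoc.prems(2) False by (cases p) auto
    have "equivalent_diagrams (tie_diagram (Plain ((p @ f) @ [Move (region_of m) (direction_of m)]))) (tie_diagram (Plain (p @ f)))"
      by (rule remove_kink) (use False hd last m in auto)
    moreover have "equivalent_diagrams (tie_diagram (Plain (p @ f))) (tie_diagram (Plain (p @ [hd f])))"
      using snoc.IH alt hd by blast
    ultimately show ?thesis
      using False equivalent_knots_trans unfolding equivalent_diagrams_def by simp
  qed
qed

lemma mirror_z_empty_diagram: "mirror_z ` knot_of empty_diagram = knot_of empty_diagram"
  unfolding knot_of_def mirror_polyline by (simp add: empty_diagram_def)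

lemma single_move_equivalent_empty: "equivalent_diagrams (tie_diagram (Plain [Move Left d])) empty_diagram"
proof -
  let ?K = "polyline [(1, 2, 0), (1, 0, 0)] \<union>
      polyline [(1, 0, 0), (0, 0, - 1), (- 2, 0, 0), (- 2, - 1, 0), (0, - 1, 0), (0, 0, 0), (- 1, 1, 0), (- 1, 2, 0), (1, 2, 0)]"
  \<comment> \<open>The diagram of \<open>L\<^sub>i\<close> is the reflection in z of that of
    \<open>L\<^sub>o\<close>, and the triangle is invariant.\<close>
  have eq: "knot_of (tie_diagram (Plain [Move Left d])) = (if d = Out then ?K else mirror_z ` ?K)"
    unfolding image_Un mirror_polyline
    by (cases d) (auto simp: knot_of_def passive_strand_def crossing_simps)
  show ?thesis
    using single_move_unknot equivalent_knots_mirror(2)[of ?K "knot_of empty_diagram"]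
    unfolding equivalent_diagrams_def eq mirror_z_empty_diagram by simp
qed

lemma shortest_tuck_equivalent_empty: "equivalent_diagrams (tie_diagram (Tucked [L\<^sub>o, R\<^sub>i, C\<^sub>o])) empty_diagram"
proof -
  have "(0, - 2/3, 0) \<in> closed_segment (0, - 4, 0) ((0, 0, 0) :: point3)"
    "(- 1, 2, 0) \<in> closed_segment (- 1, 1, 0) ((- 1, 5, 0) :: point3)"
    "(1, 2, 0) \<in> closed_segment (1, 5, 0) ((1, 0, 0) :: point3)"
    by (intro in_vertical_segment; simp)+
  then have splits:
    "closed_segment (0, - 4, 0) ((0, 0, 0) :: point3) = closed_segment (0, - 4, 0) (0, - 2/3, 0) \<union> closed_segment (0, - 2/3, 0) (0, 0, 0)"
    "closed_segment (- 1, 1, 0) ((- 1, 5, 0) :: point3) = closed_segment (- 1, 1, 0) (- 1, 2, 0) \<union> closed_segment (- 1, 2, 0) (- 1, 5, 0)"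
    "closed_segment (1, 5, 0) ((1, 0, 0) :: point3) = closed_segment (1, 5, 0) (1, 2, 0) \<union> closed_segment (1, 2, 0) (1, 0, 0)"
    using Un_closed_segment by metis+
  have list: "tie_diagram (Tucked [L\<^sub>o, R\<^sub>i, C\<^sub>o]) =
     [(0, - 4, 0), (0, 0, 0), (- 1, 1, 0), (- 1, 5, 0), (1, 5, 0), (1, 0, 0), (0, 0, - 1), (- 2, 0, 0), (- 2, - 1, 0),
      (0, - 1, 1), (3, - 1, 0), (3, 3, 0), (1, 3, - 1), (0, 3, 0), (0, 4, 0), (- 1, 4, 1), (- 5, 4, 0), (- 5, - 1/3, 0),
      (- 2, - 1/3, 1), (- 3/2, - 1/3, 0), (- 3/2, - 2/3, 0), (- 2, - 2/3, - 1), (- 5, - 2/3, 0), (- 5, - 4, 0)]"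
    by (simp add: passive_strand_def crossing_simps)
  have "knot_of (tie_diagram (Tucked [L\<^sub>o, R\<^sub>i, C\<^sub>o])) =
     polyline [(- 1, 2, 0), (- 1, 5, 0), (1, 5, 0), (1, 2, 0)] \<union>
      polyline [(1, 2, 0), (1, 0, 0), (0, 0, - 1), (- 2, 0, 0), (- 2, - 1, 0), (0, - 1, 1), (3, - 1, 0), (3, 3, 0),
        (1, 3, - 1), (0, 3, 0), (0, 4, 0), (- 1, 4, 1), (- 5, 4, 0), (- 5, - 1/3, 0), (- 2, - 1/3, 1), (- 3/2, - 1/3, 0),
        (- 3/2, - 2/3, 0), (- 2, - 2/3, - 1), (- 5, - 2/3, 0), (- 5, - 4, 0), (0, - 4, 0), (0, - 2/3, 0), (0, 0, 0),
        (- 1, 1, 0), (- 1, 2, 0)]"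
    unfolding list knot_of_def list.sel append.simps polyline.simps splits by blast
  then show ?thesis
    using shortest_tuck_unknot unfolding equivalent_diagrams_def by simp
qed

text \<open>A tie sequence begins with an L move and never repeats a letter, so an L or R move
  precedes this \<open>C\<^sub>i\<close>.\<close>

lemma tie_sequence_before_center:
  assumes "tie_sequence (Tucked (p @ C\<^sub>i # w))"
  shows "p \<noteq> []" "region_of (hd p) = Left" "region_of (last p) \<noteq> Center"
proof -
  show p: "p \<noteq> []" using assms by (cases p) auto
  then show "region_of (hd p) = Left" using assms by (cases p) auto
  show "region_of (last p) \<noteq> Center"
    using assms p by (auto simp: successively_append_iff)
qed

lemma remainder_hd: "remainder_of_tie_sequence ms \<Longrightarrow> region_of (hd ms) = Left"
  unfolding remainder_of_tie_sequence_def using tie_sequence_before_center(2) by blast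

text \<open>The conjuncts are (0), the two halves of (I), the two halves of (II), (III) and (IV),
  where \<open>hd f\<close> is the move that is kept.\<close>

theorem lemma2:
  shows
    "equivalent_diagrams (tie_diagram (Tucked [L\<^sub>o, R\<^sub>i, C\<^sub>o])) empty_diagram \<and>
     (\<forall>p. tie_sequence (Tucked (p @ [L\<^sub>i, R\<^sub>o, L\<^sub>i, C\<^sub>o])) \<longrightarrow>
        equivalent_diagrams (tie_diagram (Tucked (p @ [L\<^sub>i, R\<^sub>o, L\<^sub>i, C\<^sub>o])))
                            (tie_diagram (Plain (p @ [L\<^sub>i, C\<^sub>o, R\<^sub>i])))) \<and>
     (\<forall>p. tie_sequence (Tucked (p @ [R\<^sub>i, L\<^sub>o, R\<^sub>i, C\<^sub>o])) \<longrightarrow>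
        equivalent_diagrams (tie_diagram (Tucked (p @ [R\<^sub>i, L\<^sub>o, R\<^sub>i, C\<^sub>o])))
                            (tie_diagram (Plain (p @ [R\<^sub>i, C\<^sub>o, L\<^sub>i])))) \<and>
     (\<forall>p. tie_sequence (Tucked (p @ [C\<^sub>i, R\<^sub>o, L\<^sub>i, C\<^sub>o])) \<longrightarrow>
        equivalent_diagrams (tie_diagram (Tucked (p @ [C\<^sub>i, R\<^sub>o, L\<^sub>i, C\<^sub>o])))
                            (tie_diagram (Plain p))) \<and>
     (\<forall>p. tie_sequence (Tucked (p @ [C\<^sub>i, L\<^sub>o, R\<^sub>i, C\<^sub>o])) \<longrightarrow>
        equivalent_diagrams (tie_diagram (Tucked (p @ [C\<^sub>i, L\<^sub>o, R\<^sub>i, C\<^sub>o])))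
                            (tie_diagram (Plain p))) \<and>
     (\<forall>f. alternating_left_right f \<and> remainder_of_tie_sequence f \<longrightarrow>
        equivalent_diagrams (tie_diagram (Plain f)) empty_diagram) \<and>
     (\<forall>p d f. alternating_left_right f \<and> remainder_of_tie_sequence (p @ [Move Center d] @ f) \<longrightarrow>
        equivalent_diagrams (tie_diagram (Plain (p @ [Move Center d] @ f)))
                            (tie_diagram (Plain (p @ [Move Center d, hd f]))))"
proof (intro conjI allI impI)
  show "equivalent_diagrams (tie_diagram (Tucked [L\<^sub>o, R\<^sub>i, C\<^sub>o])) empty_diagram"
    by (rule shortest_tuck_equivalent_empty)
next
  fix p assume p: "tie_sequence (Tucked (p @ [L\<^sub>i, R\<^sub>o, L\<^sub>i, C\<^sub>o]))"
  show "equivalent_diagrams (tie_diagram (Tucked (p @ [L\<^sub>i, R\<^sub>o, L\<^sub>i, C\<^sub>o]))) (tie_diagram (Plain (p @ [L\<^sub>i, C\<^sub>o, R\<^sub>i])))"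
    by (rule reduce_tuck_after_left) (use p in \<open>cases p; auto\<close>)
next
  fix p assume p: "tie_sequence (Tucked (p @ [R\<^sub>i, L\<^sub>o, R\<^sub>i, C\<^sub>o]))"
  show "equivalent_diagrams (tie_diagram (Tucked (p @ [R\<^sub>i, L\<^sub>o, R\<^sub>i, C\<^sub>o]))) (tie_diagram (Plain (p @ [R\<^sub>i, C\<^sub>o, L\<^sub>i])))"
    by (rule reduce_tuck_after_right) (use p in \<open>cases p; auto\<close>)
next
  fix p assume "tie_sequence (Tucked (p @ [C\<^sub>i, R\<^sub>o, L\<^sub>i, C\<^sub>o]))"
  from reduce_tuck_after_center[OF tie_sequence_before_center[OF this]]
  show "equivalent_diagrams (tie_diagram (Tucked (p @ [C\<^sub>i, R\<^sub>o, L\<^sub>i, C\<^sub>o]))) (tie_diagram (Plain p))"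
    by blast
next
  fix p assume "tie_sequence (Tucked (p @ [C\<^sub>i, L\<^sub>o, R\<^sub>i, C\<^sub>o]))"
  from reduce_tuck_after_center[OF tie_sequence_before_center[OF this]]
  show "equivalent_diagrams (tie_diagram (Tucked (p @ [C\<^sub>i, L\<^sub>o, R\<^sub>i, C\<^sub>o]))) (tie_diagram (Plain p))"
    by blast
next
  fix f assume f: "alternating_left_right f \<and> remainder_of_tie_sequence f"
  \<comment> \<open>As the remainder of a tie sequence f starts with an L move, so peeling off kinks
    ends at a single L move, itself a kink.\<close>
  have hd: "region_of (hd f) = Left" using f remainder_hd by blast
  have "equivalent_diagrams (tie_diagram (Plain f)) (tie_diagram (Plain [hd f]))"
    using remove_kinks[of f "[]"] f hd by simp
  moreover have "hd f = Move Left (direction_of (hd f))" using hd by (cases "hd f") simp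
  ultimately show "equivalent_diagrams (tie_diagram (Plain f)) empty_diagram"
    using single_move_equivalent_empty[of "direction_of (hd f)"] equivalent_knots_trans
    unfolding equivalent_diagrams_def by metis
next
  fix p d f assume f: "alternating_left_right f \<and> remainder_of_tie_sequence (p @ [Move Center d] @ f)"
  have "region_of (hd ((p @ [Move Center d]) @ f)) = Left" using f remainder_hd by simp
  then show "equivalent_diagrams (tie_diagram (Plain (p @ [Move Center d] @ f)))
      (tie_diagram (Plain (p @ [Move Center d, hd f])))"
    using remove_kinks[of f "p @ [Move Center d]"] f by simp
qed

end
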